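(* Let $1<p<\infty$ and suppose $u_k\rightharpoonup u$ weakly in $W^{1,p}(\mathbb{R}^n)$. Then there exists a subsequence $(u_{k_j})$ such that $M(u_{k_j})\to M(u)$ almost everywhere in $\mathbb{R}^n$.
   Context: $Mf(x)=\sup_{R>0}\frac{1}{m(B_R)}\int_{B_R(x)}|f(y)|\,dy$ is the Hardy–Littlewood maximal operator, with $B_R(x)$ the ball of radius $R$ centered at $x$ and $m$ Lebesgue measure. *)

theory Defs
  imports "HOL-Analysis.Analysis"
begin

fun Ck :: "nat \<Rightarrow> ('a::euclidean_space \<Rightarrow> real) set" where
  "Ck 0 = {f. continuous_on UNIV f}"
| "Ck (Suc k) = {f. continuous_on UNIV f \<and> (\<forall>x. f differentiable (at x)) \<and>
      (\<forall>v. (\<lambda>x. frechet_derivative f (at x) v) \<in> Ck k)}"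

definition smooth_fun :: "('a::euclidean_space \<Rightarrow> real) \<Rightarrow> bool" where
  "smooth_fun f \<longleftrightarrow> (\<forall>k. f \<in> Ck k)"

definition test_fun :: "('a::euclidean_space \<Rightarrow> real) \<Rightarrow> bool" where
  "test_fun \<phi> \<longleftrightarrow> smooth_fun \<phi> \<and> compact (closure {x. \<phi> x \<noteq> 0})"

definition Lp :: "real \<Rightarrow> ('a::euclidean_space \<Rightarrow> real) \<Rightarrow> bool" where
  "Lp p f \<longleftrightarrow> f \<in> borel_measurable lebesgue \<and> integrable lebesgue (\<lambda>x. \<bar>f x\<bar> powr p)"

definition Lp_norm :: "real \<Rightarrow> ('a::euclidean_space \<Rightarrow> real) \<Rightarrow> real" where
  "Lp_norm p f = (\<integral>x. \<bar>f x\<bar> powr p \<partial>lebesgue) powr (1 / p)"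

definition weak_deriv :: "('a::euclidean_space \<Rightarrow> real) \<Rightarrow> 'a \<Rightarrow> ('a \<Rightarrow> real) \<Rightarrow> bool" where
  "weak_deriv u b g \<longleftrightarrow> (\<forall>\<phi>. test_fun \<phi> \<longrightarrow>
      (\<integral>x. u x * frechet_derivative \<phi> (at x) b \<partial>lebesgue) = - (\<integral>x. g x * \<phi> x \<partial>lebesgue))"

definition sobolev :: "real \<Rightarrow> ('a::euclidean_space \<Rightarrow> real) set" where
  "sobolev p = {u. Lp p u \<and> (\<forall>b\<in>Basis. \<exists>g. Lp p g \<and> weak_deriv u b g)}"

definition wderiv :: "real \<Rightarrow> ('a::euclidean_space \<Rightarrow> real) \<Rightarrow> 'a \<Rightarrow> ('a \<Rightarrow> real)" where
  "wderiv p u b = (SOME g. Lp p g \<and> weak_deriv u b g)"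

text \<open>The W^{1,p} norm (a.e.-uniqueness of weak derivatives makes it well defined).\<close>
definition sobolev_norm :: "real \<Rightarrow> ('a::euclidean_space \<Rightarrow> real) \<Rightarrow> real" where
  "sobolev_norm p u = (Lp_norm p u powr p + (\<Sum>b\<in>Basis. Lp_norm p (wderiv p u b) powr p)) powr (1 / p)"

definition sobolev_weak_conv :: "real \<Rightarrow> (nat \<Rightarrow> 'a::euclidean_space \<Rightarrow> real) \<Rightarrow> ('a \<Rightarrow> real) \<Rightarrow> bool" where
  "sobolev_weak_conv p us u \<longleftrightarrow> (\<forall>k. us k \<in> sobolev p) \<and> u \<in> sobolev p \<and>
     (\<forall>\<Phi> :: ('a \<Rightarrow> real) \<Rightarrow> real.
        (\<forall>v\<in>sobolev p. \<forall>w\<in>sobolev p. \<forall>a b::real.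
            \<Phi> (\<lambda>x. a * v x + b * w x) = a * \<Phi> v + b * \<Phi> w) \<and>
        (\<exists>C. \<forall>v\<in>sobolev p. \<bar>\<Phi> v\<bar> \<le> C * sobolev_norm p v)
        \<longrightarrow> (\<lambda>k. \<Phi> (us k)) \<longlonglongrightarrow> \<Phi> u)"

definition maximal_fun :: "('a::euclidean_space \<Rightarrow> real) \<Rightarrow> 'a \<Rightarrow> ennreal" where
  "maximal_fun f x = (SUP R\<in>{0<..}. (\<integral>\<^sup>+ y\<in>ball x R. ennreal \<bar>f y\<bar> \<partial>lebesgue) / emeasure lebesgue (ball x R))"

end

(* With w_k = u_k - u, subadditivity of the maximal operator gives |M u_k - M u| <= M w_k, so it is
   enough to find a subsequence along which M w_k tends to 0 almost everywhere.

   Weak convergence gives two uniform bounds through a gliding-hump argument: averages of |w_k| over a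
   ball B are at most C |B|^(-1/p), which handles large radii, and the pairings of w_k with derivatives
   of test functions bounded by 1 and supported in a fixed ball are bounded. By duality the second bound
   controls the local L^1 modulus of translation of w_k; comparing w_k with its averages over small balls,
   which tend to 0 pointwise, yields w_k -> 0 in L^1 on every ball. No a.e. uniqueness of weak derivatives
   is needed, because wderiv enters only through its norm.

   Along a subsequence with the integral of |w_k(j)| over the ball of radius 2(j+1) at most 4^(-j), the weak
   type (1,1) estimate (Vitali covering) and the Borel-Cantelli lemma bound the averages over radii up to
   j+1 by 2^(-j) for almost every x and all large j. *)

theory Submission
  imports Defs
begin

subsection \<open>Uniform boundedness\<close>

text \<open>The obstacle is that nothing converges globally: a bump translated to infinity tends
  weakly to 0 while its L^p norm stays fixed, so boundedness of M on L^p says nothing about M w_k,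
  and radii have to be split. Large radii see mass of bounded L^p size spread over a large ball;
  small radii see a bounded region, where the Rellich phenomenon turns weak into strong convergence.

  The uniform bounds do not pass through a bound on \<open>sobolev_norm p (us k)\<close>, which
  would call for functionals that norm a whole Sobolev function. Each bound is the uniform
  boundedness principle for one explicit family of integral functionals, v maps to the integral of v
  g. Since the bound is uniform over the family and over k together, g may be chosen depending on k,
  for instance as a multiple of the sign of w_k on a ball.\<close>

text \<open>Gliding hump on the functionals instead of Baire's theorem: the series below converges at every
  point of the sequence, so no completeness of a dual space is involved.\<close>

lemma pointwise_bounded_imp_uniformly_bounded:
  fixes F :: "('v \<Rightarrow> real) set" and x :: "nat \<Rightarrow> 'v" and B :: "nat \<Rightarrow> real"
  assumes B: "\<And>\<Phi> k. \<Phi> \<in> F \<Longrightarrow> \<bar>\<Phi> (x k)\<bar> \<le> B k"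
    and bdd: "\<And>\<Psi> c. (\<And>j. \<Psi> j \<in> F) \<Longrightarrow> (\<And>j. \<bar>c j\<bar> = (1/3) ^ j) \<Longrightarrow>
      Bseq (\<lambda>k. \<Sum>j. c j * \<Psi> j (x k))"
  shows "\<exists>C. \<forall>\<Phi>\<in>F. \<forall>k. \<bar>\<Phi> (x k)\<bar> \<le> C"
proof (rule ccontr)
  assume neg: "\<nexists>C. \<forall>\<Phi>\<in>F. \<forall>k. \<bar>\<Phi> (x k)\<bar> \<le> C"
  define N where "N k = (SUP \<Phi>\<in>F. \<bar>\<Phi> (x k)\<bar>)" for k
  have bddabove: "bdd_above ((\<lambda>\<Phi>. \<bar>\<Phi> (x k)\<bar>) ` F)" for k
    using B by (auto intro!: bdd_aboveI)
  have ne: "F \<noteq> {}" using neg by auto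
  have N_ub: "\<bar>\<Phi> (x k)\<bar> \<le> N k" if "\<Phi> \<in> F" for \<Phi> k
    unfolding N_def by (rule cSUP_upper[OF that bddabove])
  \<comment> \<open>The constants fit together: the thresholds \<open>4 ^ j\<close> outgrow the
    weights \<open>(1/3) ^ j\<close>, and the fraction \<open>3/4\<close> exceeds
    \<open>1/2\<close>, the ratio of the sum of all weights after the i-th to the i-th
    weight.\<close>
  have "\<exists>k \<Phi>. \<Phi> \<in> F \<and> N k \<ge> 4 ^ j \<and> \<bar>\<Phi> (x k)\<bar> \<ge> 3/4 * N k" for j :: nat
  proof -
    obtain \<Phi> k where "\<Phi> \<in> F" "\<bar>\<Phi> (x k)\<bar> > 4 ^ j"
      using neg by (meson not_le)
    then have Nk: "N k \<ge> 4 ^ j" using N_ub[of \<Phi> k] by linarith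
    then have "3/4 * N k < N k" using zero_less_power[of "4::real" j] by linarith
    then obtain \<Phi>' where "\<Phi>' \<in> F" "3/4 * N k < \<bar>\<Phi>' (x k)\<bar>"
      unfolding N_def using less_cSUP_iff[OF ne bddabove] by (auto simp: N_def)
    then show ?thesis using Nk by (intro exI[of _ k] exI[of _ \<Phi>']) auto
  qed
  then obtain \<kappa> \<Psi> where \<Psi>: "\<And>j. \<Psi> j \<in> F" and big: "\<And>j. N (\<kappa> j) \<ge> 4 ^ j"
    and norming: "\<And>j. \<bar>\<Psi> j (x (\<kappa> j))\<bar> \<ge> 3/4 * N (\<kappa> j)" by metis
  \<comment> \<open>Of \<open>a + b\<close> and \<open>a - b\<close> at least one has modulus at
    least \<open>\<bar>b\<bar>\<close>. With this sign the earlier terms, whatever their size,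
    cannot cancel the new hump, so the indices \<open>\<kappa> j\<close> need not be sparse.\<close>
  define step where "step j S = (if \<bar>S (x (\<kappa> j)) + (1/3)^j * \<Psi> j (x (\<kappa> j))\<bar> \<ge> (1/3)^j * \<bar>\<Psi> j (x (\<kappa> j))\<bar>
     then (1/3)^j else - ((1/3)^j) :: real)" for j :: nat and S :: "'v \<Rightarrow> real"
  define S :: "nat \<Rightarrow> 'v \<Rightarrow> real" where "S = rec_nat (\<lambda>v. 0) (\<lambda>j S v. S v + step j S * \<Psi> j v)"
  define c where "c j = step j (S j)" for j
  have cabs: "\<bar>c j\<bar> = (1/3)^j" for j by (simp add: c_def step_def)
  have S_sum: "S n v = (\<Sum>j<n. c j * \<Psi> j v)" for n v
    by (induction n) (simp_all add: S_def c_def)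
  have S_big: "\<bar>S (Suc j) (x (\<kappa> j))\<bar> \<ge> (1/3)^j * \<bar>\<Psi> j (x (\<kappa> j))\<bar>" for j
  proof -
    have "S (Suc j) (x (\<kappa> j)) = S j (x (\<kappa> j)) + c j * \<Psi> j (x (\<kappa> j))"
      by (simp add: S_sum)
    moreover have "(1/3)^j * \<bar>\<Psi> j (x (\<kappa> j))\<bar> = \<bar>(1/3)^j * \<Psi> j (x (\<kappa> j))\<bar>" by (simp add: abs_mult)
    ultimately show ?thesis by (auto simp: c_def step_def)
  qed
  have summ: "summable (\<lambda>j. c j * \<Psi> j (x k))" for k
  proof (rule summable_comparison_test')
    show "summable (\<lambda>j. (1/3)^j * B k :: real)" by (intro summable_mult2 summable_geometric) auto
    show "norm (c j * \<Psi> j (x k)) \<le> (1/3)^j * B k" for j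
      using B[OF \<Psi>] by (simp add: abs_mult cabs mult_left_mono)
  qed
  have lower: "\<bar>\<Sum>j. c j * \<Psi> j (x (\<kappa> i))\<bar> \<ge> 1/4 * (4/3)^i" for i
  proof -
    let ?f = "\<lambda>j. c j * \<Psi> j (x (\<kappa> i))" and ?N = "N (\<kappa> i)"
    have "suminf ?f = (\<Sum>j. ?f (j + Suc i)) + S (Suc i) (x (\<kappa> i))"
      using suminf_split_initial_segment[OF summ, of "\<kappa> i" "Suc i"] by (simp add: S_sum lessThan_Suc_atMost atLeast0LessThan)
    \<comment> \<open>Later terms are controlled by \<open>N (\<kappa> i)\<close> because it is a
      supremum over all of \<open>F\<close>, hence also over the functionals chosen after the
      i-th.\<close>
    moreover have "\<bar>\<Sum>j. ?f (j + Suc i)\<bar> \<le> (\<Sum>j. (1/3)^(j + Suc i) * ?N)"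
    proof -
      have s: "summable (\<lambda>j. (1/3)^(j + Suc i) * ?N)"
        unfolding power_add by (intro summable_mult2 summable_geometric) auto
      have le: "norm (?f (j + Suc i)) \<le> (1/3)^(j + Suc i) * ?N" for j
        using N_ub[OF \<Psi>] by (simp only: real_norm_def abs_mult cabs) (intro mult_left_mono, auto)
      show ?thesis using norm_suminf_le[OF le s] by simp
    qed
    moreover have "(\<Sum>j. (1/3)^(j + Suc i) * ?N) = 1/2 * ((1/3)^i * ?N)"
    proof -
      have "(\<lambda>j. (1/3)^j * ((1/3)^Suc i * ?N)) sums (1 / (1 - 1/3) * ((1/3)^Suc i * ?N))"
        by (intro sums_mult2 geometric_sums) auto
      then show ?thesis by (simp add: sums_iff power_add mult_ac)
    qed
    moreover have "\<bar>S (Suc i) (x (\<kappa> i))\<bar> \<ge> 3/4 * ((1/3)^i * ?N)"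
      using order_trans[OF mult_left_mono[OF norming] S_big, of i] by (simp add: mult_ac)
    ultimately have "\<bar>suminf ?f\<bar> \<ge> 1/4 * ((1/3)^i * ?N)" by linarith
    moreover have "(1/3)^i * ?N \<ge> (1/3)^i * 4^i" using big[of i] by (intro mult_left_mono) auto
    moreover have "(1/3)^i * 4^i = (4/3 :: real)^i" by (simp add: power_mult_distrib[symmetric])
    ultimately show ?thesis by linarith
  qed
  from bdd[of \<Psi> c, OF \<Psi> cabs] obtain K where K: "\<And>k. \<bar>\<Sum>j. c j * \<Psi> j (x k)\<bar> \<le> K"
    unfolding Bseq_def by auto
  obtain i where "(4/3::real)^i > 4 * K" using real_arch_pow[of "4/3" "4*K"] by auto
  with K[of "\<kappa> i"] lower[of i] show False by linarith
qed

subsection \<open>Test functions\<close>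

lemma Ck_continuous: "f \<in> Ck k \<Longrightarrow> continuous_on UNIV f"
  by (cases k) auto

lemma Ck_SucD: "f \<in> Ck (Suc k) \<Longrightarrow> f \<in> Ck k"
  by (induction k arbitrary: f) auto

text \<open>By uniqueness of the derivative any known derivative may stand in for
  \<open>frechet_derivative\<close>, so the inductions below can use the usual differentiation
  rules.\<close>

lemma Ck_SucI:
  assumes "\<And>x. (f has_derivative f' x) (at x)" and "\<And>v. (\<lambda>x. f' x v) \<in> Ck k"
  shows "f \<in> Ck (Suc k)"
proof -
  have "frechet_derivative f (at x) = f' x" for x
    using frechet_derivative_at[OF assms(1)] by metis
  moreover have "continuous_on UNIV f"
    using assms(1) by (meson continuous_at_imp_continuous_on has_derivative_continuous)
  ultimately show ?thesis using assms by (auto simp: differentiable_def)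
qed

lemma Ck_SucE:
  assumes "f \<in> Ck (Suc k)"
  shows "(f has_derivative frechet_derivative f (at x)) (at x)" "(\<lambda>x. frechet_derivative f (at x) v) \<in> Ck k"
  using assms frechet_derivative_works[of f "at x"] by auto

lemma Ck_const: "(\<lambda>x. c) \<in> Ck k"
  by (induction k arbitrary: c) (auto intro!: Ck_SucI[where f' = "\<lambda>_ _. 0"])

lemma Ck_add: "f \<in> Ck k \<Longrightarrow> g \<in> Ck k \<Longrightarrow> (\<lambda>x. f x + g x) \<in> Ck k"
proof (induction k arbitrary: f g)
  case (Suc k)
  show ?case
    by (rule Ck_SucI[OF has_derivative_add[OF Ck_SucE(1)[OF Suc.prems(1)] Ck_SucE(1)[OF Suc.prems(2)]]])
       (intro Suc.IH Ck_SucE Suc.prems)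
qed (auto intro: continuous_intros)

lemma Ck_mult: "f \<in> Ck k \<Longrightarrow> g \<in> Ck k \<Longrightarrow> (\<lambda>x. f x * g x) \<in> Ck k"
proof (induction k arbitrary: f g)
  case (Suc k)
  show ?case
    by (rule Ck_SucI[OF has_derivative_mult[OF Ck_SucE(1)[OF Suc.prems(1)] Ck_SucE(1)[OF Suc.prems(2)]]])
       (intro Ck_add Suc.IH Ck_SucE Suc.prems Ck_SucD[OF Suc.prems(1)] Ck_SucD[OF Suc.prems(2)])
qed (auto intro: continuous_intros)

lemma Ck_bounded_linear: "bounded_linear f \<Longrightarrow> f \<in> Ck k"
proof (cases k)
  case (Suc m)
  assume "bounded_linear f"
  then have "f \<in> Ck (Suc m)"
    by (intro Ck_SucI[where f' = "\<lambda>_. f"] Ck_const bounded_linear_imp_has_derivative)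
  with Suc show ?thesis by simp
qed (simp add: linear_continuous_on)

lemma Ck_polynomial: "real_polynomial_function f \<Longrightarrow> f \<in> Ck k"
  by (induction rule: real_polynomial_function.induct)
     (auto intro: Ck_bounded_linear Ck_const Ck_add Ck_mult)

lemma Ck_translate:
  assumes "f \<in> Ck k" shows "(\<lambda>x. f (x + a)) \<in> Ck k"
  using assms
proof (induction k arbitrary: f)
  case 0
  then show ?case
    by (auto intro!: continuous_on_compose2[of UNIV f] continuous_intros)
next
  case (Suc k)
  have "((\<lambda>x. f (x + a)) has_derivative frechet_derivative f (at (x + a))) (at x)" for x
  proof -
    have "((\<lambda>x. x + a) has_derivative (\<lambda>v. v)) (at x)"
      by (auto intro!: derivative_eq_intros)
    from has_derivative_compose[OF this Ck_SucE(1)[OF Suc.prems]] show ?thesis .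
  qed
  then show ?case
    by (rule Ck_SucI) (rule Suc.IH[OF Ck_SucE(2)[OF Suc.prems]])
qed

text \<open>The factors \<open>t ^ m\<close> make the family closed under differentiation.\<close>

definition flat :: "nat \<Rightarrow> real \<Rightarrow> real" where
  "flat m t = (if t \<le> 0 then 0 else exp (- (1 / t)) / t ^ m)"

lemma flat_tendsto_0: "((\<lambda>t. exp (- (1 / t)) / t ^ m) \<longlongrightarrow> (0::real)) (at_right 0)"
proof -
  have "((\<lambda>s::real. s ^ m / exp s) \<longlongrightarrow> 0) at_top" by (rule tendsto_power_div_exp_0)
  then have "((\<lambda>t::real. inverse t ^ m / exp (inverse t)) \<longlongrightarrow> 0) (at_right 0)"
    by (rule filterlim_compose) (rule filterlim_inverse_at_top_right)
  then show ?thesis by (simp add: exp_minus divide_simps power_inverse mult_ac)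
qed

text \<open>Away from 0 this is the quotient rule. At 0 the difference quotient vanishes from the
  left and equals \<open>flat (Suc m) h\<close> from the right, which tends to 0; the formula also
  gives 0 there.\<close>

lemma flat_deriv: "(flat m has_real_derivative (flat (m + 2) t - m * flat (m + 1) t)) (at t)"
proof -
  consider "t < 0" | "t = 0" | "t > 0" by linarith
  then show ?thesis
  proof cases
    case 1
    then have "eventually (\<lambda>s. flat m s = 0) (nhds t)"
      by (intro eventually_mono[OF eventually_nhds_in_open[of "{..<0}" t]]) (auto simp: flat_def)
    then have "(flat m has_real_derivative 0) (at t) \<longleftrightarrow> ((\<lambda>_. 0) has_real_derivative 0) (at t)"
      by (intro DERIV_cong_ev) auto
    with 1 show ?thesis by (simp add: flat_def)
  next
    case 3
    then have ev: "eventually (\<lambda>s. flat m s = exp (- (1 / s)) / s ^ m) (nhds t)"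
      by (intro eventually_mono[OF eventually_nhds_in_open[of "{0<..}" t]]) (auto simp: flat_def)
    have "((\<lambda>s. exp (- (1 / s)) / s ^ m) has_real_derivative
        (flat (m + 2) t - m * flat (m + 1) t)) (at t)"
    proof -
      have "((\<lambda>s. exp (- (1 / s))) has_real_derivative exp (- (1 / t)) / t\<^sup>2) (at t)"
        using 3 by (auto intro!: derivative_eq_intros simp: power2_eq_square)
      note D = DERIV_divide[OF this DERIV_pow[of m t UNIV]]
      \<comment> \<open>The split on \<open>m\<close> is forced by the truncated exponent
        \<open>m - Suc 0\<close>; for \<open>m = 0\<close> the factor \<open>real m\<close> removes
        that term.\<close>
      have "a / t\<^sup>2 / t ^ m - a * (real m * t ^ (m - Suc 0)) / (t ^ m * t ^ m)
          = a / t ^ (m + 2) - m * (a / t ^ (m + 1))" for a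
      proof (cases m)
        case (Suc n)
        have "t ^ n / (t ^ m * t ^ m) = 1 / t ^ (m + 1)"
          using 3 by (simp add: Suc)
        then show ?thesis using 3 by (simp add: Suc power_add power2_eq_square mult_ac)
      qed (simp add: power2_eq_square)
      then show ?thesis using 3 D by (simp add: flat_def diff_divide_distrib)
    qed
    then show ?thesis using DERIV_cong_ev[OF refl ev refl] by (rule iffD2[rotated])
  next
    case 2
    have r: "((\<lambda>h. flat m h / h) \<longlongrightarrow> 0) (at_right 0)"
    proof (rule Lim_transform_eventually[OF flat_tendsto_0[of "Suc m"]])
      show "\<forall>\<^sub>F h in at_right 0. exp (- (1 / h)) / h ^ Suc m = flat m h / h"
        by (auto simp: flat_def eventually_at_filter intro!: always_eventually)
    qed
    have l: "((\<lambda>h. flat m h / h) \<longlongrightarrow> 0) (at_left 0)"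
      by (rule tendsto_eventually) (auto simp: flat_def eventually_at_filter)
    have "((\<lambda>h. flat m h / h) \<longlongrightarrow> 0) (at 0)"
      using filterlim_split_at[OF l r] .
    then show ?thesis using 2 by (simp add: DERIV_def flat_def)
  qed
qed

lemma Ck_flat_polynomial:
  assumes "real_polynomial_function q"
  shows "(\<lambda>x. flat m (q x)) \<in> Ck k"
proof (induction k arbitrary: m)
  case 0
  have "continuous_on UNIV (flat m)"
    using flat_deriv DERIV_isCont continuous_at_imp_continuous_on by blast
  then show ?case
    using continuous_on_compose2[of UNIV "flat m" UNIV q] Ck_continuous[OF Ck_polynomial[OF assms]]
    by auto
next
  case (Suc k)
  have "((\<lambda>x. flat m (q x)) has_derivative
      (\<lambda>v. (flat (m + 2) (q x) + - real m * flat (m + 1) (q x)) * frechet_derivative q (at x) v)) (at x)" for x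
  proof -
    have "(flat m has_derivative (\<lambda>v. (flat (m + 2) (q x) - m * flat (m + 1) (q x)) * v)) (at (q x))"
      using flat_deriv[of m "q x"] by (simp add: has_field_derivative_def)
    from has_derivative_compose[OF Ck_SucE(1)[OF Ck_polynomial[OF assms]] this]
    show ?thesis by simp
  qed
  then show ?case
    by (rule Ck_SucI) (intro Ck_mult Ck_add Suc.IH Ck_const Ck_SucE(2)[OF Ck_polynomial[OF assms]])
qed

text \<open>Inside the open ball of radius \<open>r\<close> this is exp (-1 / ((n+1) (r^2 -
  |x|^2))), outside it is 0. The factor n+1 drives the exponent to 0, so the pointwise limit is the
  indicator of the open ball. Using the squared norm keeps the argument of \<open>flat\<close>
  polynomial, hence smooth at the origin too.\<close>

definition cutoff :: "real \<Rightarrow> nat \<Rightarrow> 'a::euclidean_space \<Rightarrow> real" where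
  "cutoff r n x = flat 0 (real (Suc n) * (r\<^sup>2 - x \<bullet> x))"

lemma
  fixes x :: "'a::euclidean_space"
  assumes "0 < r"
  shows cutoff_range: "0 \<le> cutoff r n x" "cutoff r n x \<le> 1"
    and cutoff_outside: "norm x \<ge> r \<Longrightarrow> cutoff r n x = 0"
    and cutoff_tendsto: "norm x < r \<Longrightarrow> (\<lambda>n. cutoff r n x) \<longlonglongrightarrow> 1"
    and cutoff_Ck: "cutoff r n \<in> (Ck k :: ('a \<Rightarrow> real) set)"
proof -
  show "0 \<le> cutoff r n x" "cutoff r n x \<le> 1"
    by (auto simp: cutoff_def flat_def)
  show "cutoff r n x = 0" if "norm x \<ge> r"
  proof -
    have "r\<^sup>2 - x \<bullet> x \<le> 0" using that assms by (simp add: dot_square_norm power_mono)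
    then show ?thesis by (simp add: cutoff_def flat_def mult_le_0_iff)
  qed
  show "(\<lambda>n. cutoff r n x) \<longlonglongrightarrow> 1" if "norm x < r"
  proof -
    define d where "d = r\<^sup>2 - x \<bullet> x"
    have d: "d > 0" using that by (simp add: d_def dot_square_norm power_strict_mono)
    have "(\<lambda>n. exp (- (inverse (real (Suc n)) / d))) \<longlonglongrightarrow> exp (- (0 / d))"
      by (intro tendsto_intros LIMSEQ_inverse_real_of_nat) (use d in auto)
    moreover have "cutoff r n x = exp (- (inverse (real (Suc n)) / d))" for n
    proof -
      have "\<not> real (Suc n) * d \<le> 0" using d by (simp add: not_le)
      then show ?thesis by (simp only: cutoff_def flat_def d_def[symmetric] if_False) (simp add: divide_simps)
    qed
    ultimately show ?thesis by simp
  qed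
  have "real_polynomial_function (\<lambda>x::'a. x \<bullet> x)"
    unfolding euclidean_inner[of x x for x]
    by (intro real_polynomial_function_sum real_polynomial_function.intros(4)
        real_polynomial_function.intros(1) bounded_linear_inner_left finite_Basis)
  then show "cutoff r n \<in> (Ck k :: ('a \<Rightarrow> real) set)"
    unfolding cutoff_def
    by (intro Ck_flat_polynomial real_polynomial_function_diff real_polynomial_function.intros(3,4,2))
qed

lemma test_fun_cutoff_polynomial:
  assumes "real_polynomial_function q" "0 < r"
  shows "test_fun (\<lambda>x. cutoff r n x * q x)"
proof -
  have "{x. cutoff r n x * q x \<noteq> 0} \<subseteq> cball 0 r"
    using cutoff_outside[OF \<open>0 < r\<close>, where n = n] by (force simp: not_le intro: less_imp_le)
  then have "bounded {x. cutoff r n x * q x \<noteq> 0}"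
    using bounded_cball bounded_subset by blast
  then show ?thesis using assms
    by (auto simp: test_fun_def smooth_fun_def intro!: Ck_mult cutoff_Ck intro: Ck_polynomial)
qed

lemma test_fun_translate:
  assumes "test_fun \<psi>" shows "test_fun (\<lambda>x. \<psi> (x + a))"
proof -
  have "{x. \<psi> (x + a) \<noteq> 0} = (+) (-a) ` {x. \<psi> x \<noteq> 0}"
  proof (intro set_eqI iffI)
    fix x assume "x \<in> {x. \<psi> (x + a) \<noteq> 0}"
    then show "x \<in> (+) (-a) ` {x. \<psi> x \<noteq> 0}"
      by (intro image_eqI[of _ _ "x + a"]) auto
  qed auto
  moreover have "bounded {x. \<psi> x \<noteq> 0}"
    using assms by (auto simp: test_fun_def)
  ultimately have "bounded {x. \<psi> (x + a) \<noteq> 0}" by (metis bounded_translation)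
  then show ?thesis using assms by (auto simp: test_fun_def smooth_fun_def intro: Ck_translate)
qed

subsection \<open>Functionals on Sobolev functions\<close>

text \<open>For \<open>a > s\<close> the factor (a/s)^(p-1) exceeds 1. The free parameter
  \<open>s\<close> is optimised after integration, which yields a Hoelder inequality.\<close>

lemma Young_scaled:
  fixes a s p :: real
  assumes "1 < p" "0 < s" "0 \<le> a"
  shows "a \<le> s + s powr (1 - p) * a powr p"
proof (cases "a \<le> s")
  case False
  then have "a = a powr (1 - p) * a powr p"
    using assms by (simp add: powr_add[symmetric])
  also have "\<dots> \<le> s powr (1 - p) * a powr p"
    using False assms by (intro mult_right_mono powr_mono2') auto
  finally show ?thesis using assms by simp
qed (simp add: add_increasing2)

lemma Lp_set_integrable:
  assumes "1 < p" "Lp p f" "E \<in> lmeasurable"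
  shows "set_integrable lebesgue E f"
  unfolding set_integrable_def
proof (rule Bochner_Integration.integrable_bound)
  show "integrable lebesgue (\<lambda>x. indicator E x + \<bar>f x\<bar> powr p)"
    using assms by (auto simp: Lp_def fmeasurable_def)
  show "(\<lambda>x. indicat_real E x *\<^sub>R f x) \<in> borel_measurable lebesgue"
    using assms by (auto simp: Lp_def)
  show "AE x in lebesgue. norm (indicat_real E x *\<^sub>R f x) \<le> norm (indicat_real E x + \<bar>f x\<bar> powr p)"
    using Young_scaled[OF \<open>1 < p\<close>, of 1] by (intro AE_I2) (auto simp: indicator_def)
qed

text \<open>Hoelder's inequality against the indicator of \<open>E\<close>, with constant 2:
  integrating \<open>Young_scaled\<close> bounds the left side by s |E| + s^(1-p) I, with I the
  integral of |f|^p, and \<open>s = (I / |E|)^(1/p)\<close> makes the two summands equal.\<close>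

lemma Lp_set_integral_le:
  assumes p: "1 < p" and f: "Lp p f" and E: "E \<in> lmeasurable" and pos: "0 < measure lebesgue E"
  shows "(LINT x:E|lebesgue. \<bar>f x\<bar>) \<le> 2 * measure lebesgue E powr (1 - 1 / p) * Lp_norm p f"
proof -
  let ?m = "measure lebesgue E"
  define I where "I = (\<integral>x. \<bar>f x\<bar> powr p \<partial>lebesgue)"
  have I0: "0 \<le> I" unfolding I_def by (rule integral_nonneg_AE) auto
  have int: "integrable lebesgue (\<lambda>x. \<bar>f x\<bar> powr p)" using f by (simp add: Lp_def)
  have absint: "set_integrable lebesgue E (\<lambda>x. \<bar>f x\<bar>)"
    using Lp_set_integrable[OF p f E] by (rule set_integrable_abs)
  have bound: "(LINT x:E|lebesgue. \<bar>f x\<bar>) \<le> s * ?m + s powr (1 - p) * I" if "0 < s" for s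
  proof -
    have "(LINT x:E|lebesgue. \<bar>f x\<bar>) \<le> (\<integral>x. s * indicator E x + s powr (1 - p) * \<bar>f x\<bar> powr p \<partial>lebesgue)"
      unfolding set_lebesgue_integral_def
    proof (rule integral_mono)
      show "integrable lebesgue (\<lambda>x. indicat_real E x *\<^sub>R \<bar>f x\<bar>)"
        using absint by (simp add: set_integrable_def)
      show "integrable lebesgue (\<lambda>x. s * indicat_real E x + s powr (1 - p) * \<bar>f x\<bar> powr p)"
        using int E by (auto simp: fmeasurable_def)
      show "indicat_real E x *\<^sub>R \<bar>f x\<bar> \<le> s * indicat_real E x + s powr (1 - p) * \<bar>f x\<bar> powr p" for x
        using Young_scaled[OF p that, of "\<bar>f x\<bar>"] by (auto simp: indicator_def)
    qed
    also have "\<dots> = s * ?m + s powr (1 - p) * I"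
      using int E by (subst Bochner_Integration.integral_add) (auto simp: fmeasurable_def I_def)
    finally show ?thesis .
  qed
  show ?thesis
  \<comment> \<open>For \<open>I = 0\<close> the balancing value of \<open>s\<close> would be 0,
    outside the range of \<open>bound\<close>; here \<open>f\<close> vanishes almost everywhere
    instead.\<close>
  proof (cases "I = 0")
    case True
    then have "AE x in lebesgue. \<bar>f x\<bar> powr p = 0"
      using integral_nonneg_eq_0_iff_AE[OF int] by (simp add: I_def)
    then have "AE x in lebesgue. indicat_real E x *\<^sub>R \<bar>f x\<bar> = 0"
      by eventually_elim simp
    then have "(LINT x:E|lebesgue. \<bar>f x\<bar>) = 0"
      unfolding set_lebesgue_integral_def by (rule integral_eq_zero_AE)
    then show ?thesis by (simp add: Lp_norm_def)
  next
    case False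
    with I0 have "I > 0" by simp
    define s where "s = (I / ?m) powr (1 / p)"
    have "s > 0" using \<open>I > 0\<close> pos by (simp add: s_def)
    have "s * ?m = ?m powr (1 - 1 / p) * I powr (1 / p)"
      using \<open>I > 0\<close> pos p by (simp add: s_def powr_divide powr_diff)
    moreover have "s powr (1 - p) * I = ?m powr (1 - 1 / p) * I powr (1 / p)"
    proof -
      have "1 / p * (1 - p) = 1 / p - 1" using p by (simp add: right_diff_distrib)
      then have "s powr (1 - p) = (I / ?m) powr (1 / p - 1)"
        by (simp only: s_def powr_powr)
      also have "\<dots> = I powr (1 / p) / I * (?m powr (1 - 1 / p))"
        using \<open>I > 0\<close> pos by (simp add: powr_divide powr_diff)
      finally show ?thesis using \<open>I > 0\<close> by simp
    qed
    ultimately show ?thesis using bound[OF \<open>s > 0\<close>] by (simp add: Lp_norm_def I_def)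
  qed
qed

lemma ball_lmeasurable: "ball (c::'a::euclidean_space) R \<in> lmeasurable"
  by simp

text \<open>Stated for an arbitrary measure because it serves both \<open>lebesgue\<close> and
  \<open>lborel\<close>.\<close>

lemma integrable_mult_bounded_support:
  fixes v g :: "'b \<Rightarrow> real"
  assumes v: "set_integrable M E v" "v \<in> borel_measurable M"
    and g: "g \<in> borel_measurable M" "\<And>x. \<bar>g x\<bar> \<le> K * indicator E x"
  shows "integrable M (\<lambda>x. v x * g x)"
    and "\<bar>\<integral>x. v x * g x \<partial>M\<bar> \<le> K * (LINT x:E|M. \<bar>v x\<bar>)"
proof -
  have i: "integrable M (\<lambda>x. K * (indicator E x *\<^sub>R \<bar>v x\<bar>))"
    using set_integrable_abs[OF v(1)] by (auto simp: set_integrable_def)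
  have le: "\<bar>v x * g x\<bar> \<le> K * (indicator E x *\<^sub>R \<bar>v x\<bar>)" for x
    using mult_left_mono[OF g(2)[of x], of "\<bar>v x\<bar>"] by (simp add: abs_mult mult_ac)
  show "integrable M (\<lambda>x. v x * g x)"
  proof (rule Bochner_Integration.integrable_bound[OF i])
    show "(\<lambda>x. v x * g x) \<in> borel_measurable M" using v g by simp
    show "AE x in M. norm (v x * g x) \<le> norm (K * (indicator E x *\<^sub>R \<bar>v x\<bar>))"
      unfolding real_norm_def by (rule AE_I2, rule order_trans[OF le abs_ge_self])
  qed
  from order_trans[OF integral_abs_bound integral_mono[OF integrable_abs[OF this] i le]]
  show "\<bar>\<integral>x. v x * g x \<partial>M\<bar> \<le> K * (LINT x:E|M. \<bar>v x\<bar>)"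
    by (simp add: set_lebesgue_integral_def)
qed

lemma powr_le_sum_powr:
  assumes "finite A" "i \<in> A" "\<And>i. i \<in> A \<Longrightarrow> 0 \<le> f i" "0 \<le> c" "0 < (p::real)"
  shows "f i \<le> (c + (\<Sum>i\<in>A. f i powr p)) powr (1 / p)"
proof -
  have "f i = (f i powr p) powr (1 / p)" using assms by (simp add: powr_powr)
  also have "f i powr p \<le> (\<Sum>i\<in>A. f i powr p)" using assms by (intro member_le_sum) auto
  then have "(f i powr p) powr (1 / p) \<le> (c + (\<Sum>i\<in>A. f i powr p)) powr (1 / p)"
    using assms by (intro powr_mono2) auto
  finally show ?thesis .
qed

lemma Lp_norm_le_sobolev_norm:
  assumes "1 < p"
  shows "Lp_norm p v \<le> sobolev_norm p v"
proof -
  have "Lp_norm p v = (Lp_norm p v powr p) powr (1 / p)"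
    using assms by (simp add: powr_powr Lp_norm_def)
  also have "\<dots> \<le> sobolev_norm p v"
    unfolding sobolev_norm_def using assms by (intro powr_mono2) (auto intro: sum_nonneg)
  finally show ?thesis .
qed

lemma Lp_norm_wderiv_le_sobolev_norm:
  assumes "1 < p" "b \<in> Basis"
  shows "Lp_norm p (wderiv p v b) \<le> sobolev_norm p v"
  unfolding sobolev_norm_def using assms by (intro powr_le_sum_powr) (auto simp: Lp_norm_def)

lemma sobolev_wderiv:
  assumes "v \<in> sobolev p" "b \<in> Basis"
  shows "Lp p (wderiv p v b)" "weak_deriv v b (wderiv p v b)"
proof -
  have "\<exists>g. Lp p g \<and> weak_deriv v b g" using assms by (auto simp: sobolev_def)
  from someI_ex[OF this] show "Lp p (wderiv p v b)" "weak_deriv v b (wderiv p v b)"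
    by (auto simp: wderiv_def)
qed

section \<open>Derivatives of test functions\<close>

lemma test_fun_continuous: "test_fun \<psi> \<Longrightarrow> continuous_on UNIV \<psi>"
  by (auto simp: test_fun_def smooth_fun_def intro: Ck_continuous)

lemma test_fun_has_derivative:
  assumes "test_fun \<psi>"
  shows "(\<psi> has_derivative frechet_derivative \<psi> (at x)) (at x)"
  using assms Ck_SucE(1)[of \<psi> 0 x] by (auto simp: test_fun_def smooth_fun_def simp del: Ck.simps)

lemma test_fun_derivative_continuous:
  assumes "test_fun \<psi>"
  shows "continuous_on UNIV (\<lambda>x. frechet_derivative \<psi> (at x) b)"
  using assms by (intro Ck_continuous[of _ 0] Ck_SucE(2)) (simp add: test_fun_def smooth_fun_def del: Ck.simps)

text \<open>The margin 1 puts \<open>x\<close> into the open complement of \<open>cball 0 r\<close>,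
  where \<open>\<psi>\<close> vanishes identically.\<close>

lemma frechet_derivative_zero_outside:
  fixes \<psi> :: "'a::euclidean_space \<Rightarrow> real"
  assumes "\<And>x. x \<notin> ball 0 r \<Longrightarrow> \<psi> x = 0" "x \<notin> ball 0 (r + 1)"
  shows "frechet_derivative \<psi> (at x) b = (0::real)"
proof -
  have "x \<in> - cball 0 r" using assms(2) by auto
  with has_derivative_const[of 0] have "(\<psi> has_derivative (\<lambda>_. 0)) (at x)"
    by (rule has_derivative_transform_within_open[OF _ open_Compl[OF closed_cball]])
       (use assms(1) in auto)
  then show ?thesis using frechet_derivative_at by metis
qed

lemma test_fun_derivative_bounded:
  fixes \<psi> :: "'a::euclidean_space \<Rightarrow> real"
  assumes "test_fun \<psi>" "\<And>x. x \<notin> ball 0 r \<Longrightarrow> \<psi> x = 0"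
  obtains K where "0 \<le> K" "\<And>x. \<bar>frechet_derivative \<psi> (at x) b\<bar> \<le> K * indicator (ball 0 (r + 1)) x"
proof -
  have "compact ((\<lambda>x. frechet_derivative \<psi> (at x) b) ` cball 0 (r + 1))"
    using test_fun_derivative_continuous[OF assms(1)]
    by (intro compact_continuous_image) (auto intro: continuous_on_subset)
  from compact_imp_bounded[OF this]
  obtain K where K: "\<forall>x\<in>cball 0 (r + 1). \<bar>frechet_derivative \<psi> (at x) b\<bar> \<le> K"
    unfolding bounded_iff by auto
  have "\<bar>frechet_derivative \<psi> (at x) b\<bar> \<le> \<bar>K\<bar> * indicator (ball 0 (r + 1)) x" for x
  proof (cases "x \<in> ball 0 (r + 1)")
    case True
    then have "\<bar>frechet_derivative \<psi> (at x) b\<bar> \<le> K" using K by auto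
    then show ?thesis using True by simp
  next
    case False
    then have "frechet_derivative \<psi> (at x) b = 0"
      by (intro frechet_derivative_zero_outside[of r \<psi>] assms(2))
    then show ?thesis by simp
  qed
  then show ?thesis by (intro that[of "\<bar>K\<bar>"]) auto
qed

lemma continuous_imp_lebesgue_measurable:
  "continuous_on UNIV f \<Longrightarrow> f \<in> borel_measurable lebesgue"
  for f :: "'a::euclidean_space \<Rightarrow> real"
  by (metis borel_measurable_continuous_onI measurable_completion measurable_lborel2 measurable_lborel1)

section \<open>Pairings along weakly convergent sequences\<close>

lemma sobolev_weak_conv_pairing:
  assumes p: "1 < p" and conv: "sobolev_weak_conv p us u"
    and intg: "\<And>v. v \<in> sobolev p \<Longrightarrow> integrable lebesgue (\<lambda>x. v x * g x)"
    and bnd: "\<And>v. v \<in> sobolev p \<Longrightarrow> \<bar>\<integral>x. v x * g x \<partial>lebesgue\<bar> \<le> K * sobolev_norm p v"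
  shows "(\<lambda>k. \<integral>x. us k x * g x \<partial>lebesgue) \<longlonglongrightarrow> (\<integral>x. u x * g x \<partial>lebesgue)"
proof -
  have "\<forall>v\<in>sobolev p. \<forall>w\<in>sobolev p. \<forall>a b::real.
      (\<integral>x. (a * v x + b * w x) * g x \<partial>lebesgue)
      = a * (\<integral>x. v x * g x \<partial>lebesgue) + b * (\<integral>x. w x * g x \<partial>lebesgue)"
    using intg by (simp add: distrib_right mult.assoc)
  moreover have "\<exists>C. \<forall>v\<in>sobolev p. \<bar>\<integral>x. v x * g x \<partial>lebesgue\<bar> \<le> C * sobolev_norm p v"
    using bnd by blast
  ultimately show ?thesis
    using conv[unfolded sobolev_weak_conv_def, THEN conjunct2, THEN conjunct2,
      THEN spec[of _ "\<lambda>v. \<integral>x. v x * g x \<partial>lebesgue"]] by blast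
qed

text \<open>Because \<open>K\<close> does not depend on \<open>g\<close>, a series of pairings with
  weights \<open>(1/3) ^ j\<close> and arbitrary signs is again linear and bounded on
  \<open>sobolev p\<close>, with constant \<open>3/2 * K\<close>, the factor being the sum of the
  weights. Weak convergence therefore applies to the series itself, so its values along
  \<open>us\<close> converge and are bounded, which is the hypothesis of the gliding hump.\<close>

lemma sobolev_weak_conv_uniform:
  assumes p: "1 < p" and conv: "sobolev_weak_conv p us u"
    and intg: "\<And>v g. v \<in> sobolev p \<Longrightarrow> g \<in> G \<Longrightarrow> integrable lebesgue (\<lambda>x. v x * g x)"
    and bnd: "\<And>v g. v \<in> sobolev p \<Longrightarrow> g \<in> G \<Longrightarrow> \<bar>\<integral>x. v x * g x \<partial>lebesgue\<bar> \<le> K * sobolev_norm p v"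
  shows "\<exists>C. \<forall>g\<in>G. \<forall>k. \<bar>(\<integral>x. us k x * g x \<partial>lebesgue) - (\<integral>x. u x * g x \<partial>lebesgue)\<bar> \<le> C"
proof -
  define F where "F = (\<lambda>g v. \<integral>x. v x * g x \<partial>lebesgue) ` G"
  have us: "us k \<in> sobolev p" for k
    using conv by (simp add: sobolev_weak_conv_def)
  have u: "u \<in> sobolev p"
    using conv by (simp add: sobolev_weak_conv_def)
  have F_bnd: "\<bar>\<Phi> v\<bar> \<le> K * sobolev_norm p v" if "\<Phi> \<in> F" "v \<in> sobolev p" for \<Phi> v
    using that bnd by (auto simp: F_def)
  have F_lin: "\<Phi> (\<lambda>x. a * v x + b * w x) = a * \<Phi> v + b * \<Phi> w"
    if "\<Phi> \<in> F" "v \<in> sobolev p" "w \<in> sobolev p" for \<Phi> v w and a b :: real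
    using that intg by (auto simp: F_def distrib_right mult.assoc)
  have "\<exists>C. \<forall>\<Phi>\<in>F. \<forall>k. \<bar>\<Phi> (us k)\<bar> \<le> C"
  proof (rule pointwise_bounded_imp_uniformly_bounded)
    show "\<bar>\<Phi> (us k)\<bar> \<le> K * sobolev_norm p (us k)" if "\<Phi> \<in> F" for \<Phi> k
      using F_bnd[OF that us] .
    fix \<Psi> :: "nat \<Rightarrow> ('a \<Rightarrow> real) \<Rightarrow> real" and c :: "nat \<Rightarrow> real"
    assume \<Psi>: "\<And>j. \<Psi> j \<in> F" and c: "\<And>j. \<bar>c j\<bar> = (1/3)^j"
    have le: "norm (c j * \<Psi> j v) \<le> (1/3)^j * (K * sobolev_norm p v)" if "v \<in> sobolev p" for j v
      using F_bnd[OF \<Psi> that] by (simp add: abs_mult c mult_left_mono)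
    have geo: "summable (\<lambda>j. (1/3)^j * M :: real)" for M
      by (intro summable_mult2 summable_geometric) auto
    have summ: "summable (\<lambda>j. c j * \<Psi> j v)" if "v \<in> sobolev p" for v
      by (rule summable_comparison_test'[OF geo le[OF that]])
    define \<Phi> where "\<Phi> v = (\<Sum>j. c j * \<Psi> j v)" for v
    have "\<Phi> (\<lambda>x. a * v x + b * w x) = a * \<Phi> v + b * \<Phi> w"
      if "v \<in> sobolev p" "w \<in> sobolev p" for v w and a b :: real
    proof -
      have "\<Phi> (\<lambda>x. a * v x + b * w x) = (\<Sum>j. a * (c j * \<Psi> j v) + b * (c j * \<Psi> j w))"
        using F_lin[OF \<Psi> that] by (simp add: \<Phi>_def algebra_simps)
      also have "\<dots> = a * \<Phi> v + b * \<Phi> w"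
        using summ[OF that(1)] summ[OF that(2)]
        by (simp add: \<Phi>_def suminf_add[symmetric] suminf_mult summable_mult)
      finally show ?thesis .
    qed
    moreover have "\<bar>\<Phi> v\<bar> \<le> (3/2 * K) * sobolev_norm p v" if "v \<in> sobolev p" for v
    proof -
      have "(\<Sum>j. (1/3)^j * (K * sobolev_norm p v)) = 3/2 * (K * sobolev_norm p v)"
        using sums_mult2[OF geometric_sums[of "1/3::real"], of "K * sobolev_norm p v"] by (simp add: sums_iff)
      then show ?thesis using norm_suminf_le[OF le[OF that] geo] by (simp add: \<Phi>_def)
    qed
    ultimately have "(\<lambda>k. \<Phi> (us k)) \<longlonglongrightarrow> \<Phi> u"
      using conv unfolding sobolev_weak_conv_def by blast
    then show "Bseq (\<lambda>k. \<Sum>j. c j * \<Psi> j (us k))"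
      unfolding \<Phi>_def by (intro convergent_imp_Bseq convergentI)
  qed
  then obtain C where C: "\<And>\<Phi> k. \<Phi> \<in> F \<Longrightarrow> \<bar>\<Phi> (us k)\<bar> \<le> C" by blast
  have "\<bar>(\<integral>x. us k x * g x \<partial>lebesgue) - (\<integral>x. u x * g x \<partial>lebesgue)\<bar> \<le> C + K * sobolev_norm p u"
    if "g \<in> G" for g k
    using C[of "\<lambda>v. \<integral>x. v x * g x \<partial>lebesgue" k] bnd[OF u that] that by (fastforce simp: F_def)
  then show ?thesis by blast
qed

lemma bounded_support_pairing:
  fixes g :: "'a::euclidean_space \<Rightarrow> real"
  assumes p: "1 < p" and v: "v \<in> sobolev p" and "0 < R" "0 \<le> K"
    and g: "g \<in> borel_measurable lebesgue" "\<And>x. \<bar>g x\<bar> \<le> K * indicator (ball c R) x"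
  shows "integrable lebesgue (\<lambda>x. v x * g x)"
    and "\<bar>\<integral>x. v x * g x \<partial>lebesgue\<bar>
      \<le> K * (2 * measure lebesgue (ball c R) powr (1 - 1 / p)) * sobolev_norm p v"
proof -
  have Lp: "Lp p v" using v by (simp add: sobolev_def)
  then have m: "v \<in> borel_measurable lebesgue" by (simp add: Lp_def)
  note i = Lp_set_integrable[OF p Lp ball_lmeasurable[of c R]]
  show "integrable lebesgue (\<lambda>x. v x * g x)"
    by (rule integrable_mult_bounded_support(1)[OF i m g])
  have "0 < measure lebesgue (ball c R)"
    using \<open>0 < R\<close> content_ball_pos[of R c] by simp
  then have "(LINT x:ball c R|lebesgue. \<bar>v x\<bar>) \<le> 2 * measure lebesgue (ball c R) powr (1 - 1 / p) * Lp_norm p v"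
    by (rule Lp_set_integral_le[OF p Lp ball_lmeasurable])
  also have "\<dots> \<le> 2 * measure lebesgue (ball c R) powr (1 - 1 / p) * sobolev_norm p v"
    by (intro mult_left_mono Lp_norm_le_sobolev_norm p) auto
  finally have "K * (LINT x:ball c R|lebesgue. \<bar>v x\<bar>) \<le> K * (2 * measure lebesgue (ball c R) powr (1 - 1 / p) * sobolev_norm p v)"
    using \<open>0 \<le> K\<close> by (rule mult_left_mono)
  with integrable_mult_bounded_support(2)[OF i m g]
  show "\<bar>\<integral>x. v x * g x \<partial>lebesgue\<bar>
      \<le> K * (2 * measure lebesgue (ball c R) powr (1 - 1 / p)) * sobolev_norm p v"
    by (simp add: mult_ac)
qed

text \<open>The weak derivative moves the differentiation from \<open>\<psi>\<close> to
  \<open>v\<close>, so the bound sees only \<open>\<bar>\<psi> x\<bar> \<le> 1\<close> and the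
  radius, however large the derivative of \<open>\<psi>\<close> is. The size \<open>K\<close> of
  that derivative enters only into integrability. This independence makes the derivatives a family
  with a common constant.\<close>

lemma derivative_pairing:
  fixes \<psi> :: "'a::euclidean_space \<Rightarrow> real"
  assumes p: "1 < p" and v: "v \<in> sobolev p" and "0 < r" and b: "b \<in> Basis"
    and \<psi>: "test_fun \<psi>" "\<And>x. x \<notin> ball 0 r \<Longrightarrow> \<psi> x = 0" "\<And>x. \<bar>\<psi> x\<bar> \<le> 1"
  shows "integrable lebesgue (\<lambda>x. v x * frechet_derivative \<psi> (at x) b)"
    and "\<bar>\<integral>x. v x * frechet_derivative \<psi> (at x) b \<partial>lebesgue\<bar>
      \<le> 2 * measure lebesgue (ball (0::'a) r) powr (1 - 1 / p) * sobolev_norm p v"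
proof -
  have Lp: "Lp p v" using v by (simp add: sobolev_def)
  then have m: "v \<in> borel_measurable lebesgue" by (simp add: Lp_def)
  obtain K where K: "\<And>x. \<bar>frechet_derivative \<psi> (at x) b\<bar> \<le> K * indicator (ball 0 (r + 1)) x"
    using test_fun_derivative_bounded[OF \<psi>(1,2)] by blast
  show "integrable lebesgue (\<lambda>x. v x * frechet_derivative \<psi> (at x) b)"
    by (rule integrable_mult_bounded_support(1)[OF Lp_set_integrable[OF p Lp ball_lmeasurable] m
      continuous_imp_lebesgue_measurable[OF test_fun_derivative_continuous[OF \<psi>(1)]] K])
  let ?g = "wderiv p v b"
  note g = sobolev_wderiv[OF v b]
  have "\<bar>\<integral>x. v x * frechet_derivative \<psi> (at x) b \<partial>lebesgue\<bar> = \<bar>\<integral>x. ?g x * \<psi> x \<partial>lebesgue\<bar>"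
    using g(2) \<psi>(1) by (simp add: weak_deriv_def)
  also have "\<dots> \<le> 1 * (LINT x:ball 0 r|lebesgue. \<bar>?g x\<bar>)"
    by (rule integrable_mult_bounded_support(2)[OF Lp_set_integrable[OF p g(1) ball_lmeasurable]])
       (use g(1) \<psi> test_fun_continuous[OF \<psi>(1)] in \<open>auto simp: Lp_def indicator_def intro: continuous_imp_lebesgue_measurable\<close>)
  also have "\<dots> \<le> 2 * measure lebesgue (ball (0::'a) r) powr (1 - 1 / p) * Lp_norm p ?g"
    using Lp_set_integral_le[OF p g(1) ball_lmeasurable[of 0 r]] \<open>0 < r\<close> content_ball_pos[of r "0::'a"] by simp
  also have "\<dots> \<le> 2 * measure lebesgue (ball (0::'a) r) powr (1 - 1 / p) * sobolev_norm p v"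
    by (intro mult_left_mono Lp_norm_wderiv_le_sobolev_norm p b) auto
  finally show "\<bar>\<integral>x. v x * frechet_derivative \<psi> (at x) b \<partial>lebesgue\<bar>
      \<le> 2 * measure lebesgue (ball (0::'a) r) powr (1 - 1 / p) * sobolev_norm p v" .
qed

subsection \<open>Translations and local convergence\<close>

text \<open>A Lebesgue measurable function is a limit of continuous ones off a negligible set.
  Clamping them to [-1, 1] keeps the limit, since \<open>sgn\<close> takes its values there.\<close>

lemma continuous_approx_sgn:
  fixes w :: "'a::euclidean_space \<Rightarrow> real"
  assumes "w \<in> borel_measurable borel"
  obtains h where "\<And>n. continuous_on UNIV (h n)" "\<And>n x. \<bar>h n x\<bar> \<le> 1"
    "AE x in lborel. (\<lambda>n. h n x) \<longlonglongrightarrow> sgn (w x)"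
proof -
  have "(\<lambda>x. sgn (w x)) \<in> borel_measurable lebesgue"
    using assms by (intro measurable_completion) simp
  from lebesgue_measurable_imp_measurable_on_real[OF this, of UNIV]
  obtain N g where N: "negligible N" and g: "\<And>n. continuous_on UNIV (g n)"
    and lim: "\<And>x. x \<notin> N \<Longrightarrow> (\<lambda>n. g n x) \<longlonglongrightarrow> sgn (w x)"
    unfolding measurable_on_def by auto
  define h where "h n x = max (-1) (min 1 (g n x))" for n x
  show ?thesis
  proof
    show "continuous_on UNIV (h n)" for n
      unfolding h_def by (intro continuous_intros g)
    show "\<bar>h n x\<bar> \<le> 1" for n x by (auto simp: h_def)
    have "(\<lambda>n. h n x) \<longlonglongrightarrow> sgn (w x)" if "x \<notin> N" for x
    proof -
      have "(\<lambda>n. h n x) \<longlonglongrightarrow> max (-1) (min 1 (sgn (w x)))"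
        unfolding h_def by (intro tendsto_intros lim that)
      moreover have "max (-1) (min 1 (sgn (w x))) = sgn (w x)" by (simp add: sgn_if)
      ultimately show ?thesis by simp
    qed
    moreover have "N \<in> null_sets lebesgue" using N negligible_iff_null_sets by blast
    ultimately have "AE x in lebesgue. (\<lambda>n. h n x) \<longlonglongrightarrow> sgn (w x)"
      by (intro AE_I'[of N]) auto
    then show "AE x in lborel. (\<lambda>n. h n x) \<longlonglongrightarrow> sgn (w x)"
      by (simp add: AE_completion_iff)
  qed
qed

text \<open>The sign of \<open>w\<close> is an a.e. limit of continuous functions, which Stone--Weierstrass replaces by
  polynomials on the closed ball; multiplying by cutoffs makes these test functions.\<close>

lemma set_integral_abs_le_of_test_fun:
  fixes w :: "'a::euclidean_space \<Rightarrow> real" and r C :: real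
  assumes w[measurable]: "w \<in> borel_measurable borel" and int_w: "set_integrable lborel (ball 0 r) w" and r: "0 < r"
    and C: "\<And>\<psi>. test_fun \<psi> \<Longrightarrow> (\<And>x. \<bar>\<psi> x\<bar> \<le> 1) \<Longrightarrow> (\<And>x. x \<notin> ball 0 r \<Longrightarrow> \<psi> x = 0)
      \<Longrightarrow> \<bar>\<integral>x. w x * \<psi> x \<partial>lborel\<bar> \<le> C"
  shows "(LINT x:ball 0 r|lborel. \<bar>w x\<bar>) \<le> C"
proof -
  obtain h where h: "\<And>n. continuous_on UNIV (h n)" "\<And>n x. \<bar>h n x\<bar> \<le> 1"
    "AE x in lborel. (\<lambda>n. h n x) \<longlonglongrightarrow> sgn (w x)"
    using continuous_approx_sgn[OF w] by blast
  define e where "e n = inverse (real (Suc n))" for n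
  have e: "e n > 0" for n by (simp add: e_def)
  have e0: "e \<longlonglongrightarrow> 0" unfolding e_def by (rule LIMSEQ_inverse_real_of_nat)
  have "\<exists>q. real_polynomial_function q \<and> (\<forall>x\<in>cball 0 r. \<bar>h n x - q x\<bar> < e n)" for n
    using Stone_Weierstrass_real_polynomial_function[OF compact_cball continuous_on_subset[OF h(1)[of n] subset_UNIV] e]
    by metis
  then obtain q where q: "\<And>n. real_polynomial_function (q n)"
    and hq: "\<And>n x. x \<in> cball 0 r \<Longrightarrow> \<bar>h n x - q n x\<bar> < e n" by metis
  \<comment> \<open>On the ball \<open>q n\<close> may exceed 1 in modulus by up to
    \<open>e n\<close>; dividing by \<open>1 + e n\<close> restores the bound 1. The one index
    \<open>n\<close> drives both the cutoff and the approximation.\<close>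
  define \<psi> where "\<psi> n x = cutoff r n x * (q n x / (1 + e n))" for n x
  have test: "test_fun (\<psi> n)" for n
    unfolding \<psi>_def by (intro test_fun_cutoff_polynomial real_polynomial_function_divide q r)
  have out: "\<psi> n x = 0" if "x \<notin> ball 0 r" for n x
    using cutoff_outside[OF r, of x n] that by (simp add: \<psi>_def)
  have le1: "\<bar>\<psi> n x\<bar> \<le> 1" for n x
  proof (cases "x \<in> ball 0 r")
    case True
    then have "\<bar>q n x\<bar> \<le> 1 + e n" using hq[of x n] h(2)[of n x] by simp
    then have "\<bar>q n x / (1 + e n)\<bar> \<le> 1" using e[of n] by simp
    then show ?thesis
      using mult_mono[of "cutoff r n x" 1 "\<bar>q n x / (1 + e n)\<bar>" 1] cutoff_range[OF r, of n x]
      by (simp add: \<psi>_def abs_mult)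
  qed (simp add: out)
  have lim: "AE x in lborel. (\<lambda>n. w x * \<psi> n x) \<longlonglongrightarrow> indicator (ball 0 r) x *\<^sub>R \<bar>w x\<bar>"
    using h(3)
  proof eventually_elim
    case (elim x)
    show ?case
    proof (cases "x \<in> ball 0 r")
      case True
      have "(\<lambda>n. h n x - q n x) \<longlonglongrightarrow> 0"
        by (rule Lim_null_comparison[OF _ e0]) (use True in \<open>auto intro!: always_eventually less_imp_le[OF hq]\<close>)
      from tendsto_diff[OF elim this] have "(\<lambda>n. q n x) \<longlonglongrightarrow> sgn (w x)" by simp
      then have "(\<lambda>n. w x * \<psi> n x) \<longlonglongrightarrow> w x * (1 * (sgn (w x) / (1 + 0)))"
        unfolding \<psi>_def using True by (intro tendsto_intros cutoff_tendsto r e0) auto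
      then show ?thesis using True by (simp add: abs_sgn)
    qed (simp add: out)
  qed
  have int: "integrable lborel (\<lambda>x. indicator (ball 0 r) x *\<^sub>R \<bar>w x\<bar>)"
    using set_integrable_abs[OF int_w] by (simp add: set_integrable_def)
  have [measurable]: "\<psi> n \<in> borel_measurable borel" for n
    by (intro borel_measurable_continuous_onI test_fun_continuous test)
  have "(\<lambda>n. \<integral>x. w x * \<psi> n x \<partial>lborel) \<longlonglongrightarrow> (\<integral>x. indicator (ball 0 r) x *\<^sub>R \<bar>w x\<bar> \<partial>lborel)"
  proof (rule integral_dominated_convergence[OF _ _ int lim])
    show "AE x in lborel. norm (w x * \<psi> n x) \<le> indicator (ball 0 r) x *\<^sub>R \<bar>w x\<bar>" for n
      using mult_left_mono[OF le1[of n], of "\<bar>w x\<bar>" for x] out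
      by (intro AE_I2) (auto simp: indicator_def abs_mult)
  qed (use borel_measurable_integrable[OF int] in auto)
  then have "\<bar>\<integral>x. indicator (ball 0 r) x *\<^sub>R \<bar>w x\<bar> \<partial>lborel\<bar> \<le> C"
    by (rule LIMSEQ_le_const2[OF tendsto_rabs]) (blast intro: C[OF test le1 out])
  then show ?thesis by (simp add: set_lebesgue_integral_def)
qed

section \<open>Translations and the L^1 modulus of continuity\<close>

lemma set_integrable_translate:
  fixes w :: "'a::euclidean_space \<Rightarrow> real"
  assumes "\<And>r. set_integrable lborel (ball 0 r) w"
  shows "set_integrable lborel (ball 0 r) (\<lambda>x. w (x + y))"
proof -
  have "set_integrable lborel (ball y r) w"
  proof (rule set_integrable_subset[OF assms[of "norm y + r"]])
    have "norm x < norm y + r" if "norm (y - x) < r" for x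
      using that norm_triangle_sub[of x y] by (simp add: norm_minus_commute)
    then show "ball y r \<subseteq> ball 0 (norm y + r)" by (auto simp: dist_norm)
  qed simp
  then have "integrable (distr lborel borel ((+) y)) (\<lambda>x. indicator (ball y r) x *\<^sub>R w x)"
    by (simp add: set_integrable_def lborel_distr_plus)
  then have "integrable lborel (\<lambda>x. indicator (ball y r) (y + x) *\<^sub>R w (y + x))"
    by (rule integrable_distr[rotated]) simp
  moreover have "indicat_real (ball y r) (y + x) = indicator (ball 0 r) x" for x
    by (auto simp: indicator_def dist_norm)
  ultimately show ?thesis by (simp add: set_integrable_def add.commute)
qed

lemma lborel_integral_translate:
  fixes f :: "'a::euclidean_space \<Rightarrow> real"
  assumes [measurable]: "f \<in> borel_measurable borel"
  shows "(\<integral>x. f (x + y) \<partial>lborel) = (\<integral>x. f x \<partial>lborel)"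
proof -
  have "(\<integral>x. f x \<partial>lborel) = (\<integral>x. f x \<partial>distr lborel borel ((+) y))"
    by (simp add: lborel_distr_plus)
  also have "\<dots> = (\<integral>x. f (x + y) \<partial>lborel)"
    by (subst integral_distr) (simp_all add: add.commute)
  finally show ?thesis by simp
qed

lemma integrable_mult_bounded_support_lborel:
  fixes v g :: "'a::euclidean_space \<Rightarrow> real"
  assumes "set_integrable lborel E v" "v \<in> borel_measurable borel"
    and "g \<in> borel_measurable borel" "\<And>x. \<bar>g x\<bar> \<le> K * indicator E x"
  shows "integrable lborel (\<lambda>x. v x * g x)"
  by (rule integrable_mult_bounded_support(1)[of lborel E v g K]) (use assms in auto)

text \<open>Writing \<open>\<psi> (x - y) - \<psi> x\<close> as the integral of \<open>- D\<psi> (x - t y) y\<close> over \<open>t\<close> in \<open>{0..1}\<close> and swapping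
  integrals leaves, for each \<open>t\<close>, a pairing with derivatives of a translated test function.\<close>

lemma translation_test_estimate:
  fixes w :: "'a::euclidean_space \<Rightarrow> real" and r C :: real
  assumes w[measurable]: "w \<in> borel_measurable borel" and loc: "\<And>r. set_integrable lborel (ball 0 r) w"
    and \<psi>: "test_fun \<psi>" "\<And>x. \<bar>\<psi> x\<bar> \<le> 1" "\<And>x. x \<notin> ball 0 r \<Longrightarrow> \<psi> x = 0" and y: "norm y \<le> 1"
    and C: "\<And>\<phi> b. test_fun \<phi> \<Longrightarrow> (\<And>x. \<bar>\<phi> x\<bar> \<le> 1) \<Longrightarrow> (\<And>x. x \<notin> ball 0 (r + 1) \<Longrightarrow> \<phi> x = 0)
      \<Longrightarrow> b \<in> Basis \<Longrightarrow> \<bar>\<integral>x. w x * frechet_derivative \<phi> (at x) b \<partial>lborel\<bar> \<le> C"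
  shows "\<bar>\<integral>x. w x * (\<psi> (x - y) - \<psi> x) \<partial>lborel\<bar> \<le> DIM('a) * C * norm y"
proof -
  define D where "D b x = frechet_derivative \<psi> (at x) b" for b x
  have Dcont: "continuous_on UNIV (D b)" for b
    unfolding D_def by (rule test_fun_derivative_continuous[OF \<psi>(1)])
  \<comment> \<open>The hypothesis \<open>C\<close> covers only basis directions. Expanding the
    direction \<open>y\<close> in the basis is the origin of the factor
    \<open>DIM('a)\<close>.\<close>
  have Dlin: "D y x = (\<Sum>b\<in>Basis. (y \<bullet> b) * D b x)" for x
  proof -
    interpret linear "frechet_derivative \<psi> (at x)"
      using test_fun_has_derivative[OF \<psi>(1)] has_derivative_linear by blast
    have "D y x = frechet_derivative \<psi> (at x) (\<Sum>b\<in>Basis. (y \<bullet> b) *\<^sub>R b)"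
      by (simp add: D_def euclidean_representation)
    then show ?thesis by (simp add: sum scale D_def)
  qed
  obtain K where K0: "0 \<le> K" and K: "\<And>x. \<bar>D y x\<bar> \<le> K * indicator (ball 0 (r + 1)) x"
    unfolding D_def using test_fun_derivative_bounded[OF \<psi>(1,3)] by blast
  have [measurable]: "D b \<in> borel_measurable borel" for b
    by (intro borel_measurable_continuous_onI Dcont)
  define F where "F x t = indicator {0..1} t * (w x * D y (x - t *\<^sub>R y))" for x and t :: real
  have norm_ty: "norm (t *\<^sub>R y) \<le> 1" if "t \<in> {0..1}" for t
    using that y mult_mono[of "\<bar>t\<bar>" 1 "norm y" 1] by simp
  have inb: "x \<in> ball 0 (R + 1)" if "x - t *\<^sub>R y \<in> ball 0 R" "t \<in> {0..1}" for x t R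
    using that(1) norm_ty[OF that(2)] norm_triangle_ineq[of "x - t *\<^sub>R y" "t *\<^sub>R y"] by simp
  \<comment> \<open>Of the two margins 1, one comes from the support bound for the derivative of
    \<open>\<psi>\<close>, the other from the shift by a vector of norm at most 1. This domination
    gives the integrability that Fubini requires.\<close>
  have Fle: "\<bar>F x t\<bar> \<le> K * (indicator {0..1} t * (indicator (ball 0 (r + 1 + 1)) x * \<bar>w x\<bar>))" for x t
  proof (cases "t \<in> {0..1} \<and> x - t *\<^sub>R y \<in> ball 0 (r + 1)")
    case True
    then have "\<bar>D y (x - t *\<^sub>R y)\<bar> \<le> K" using K[of "x - t *\<^sub>R y"] by simp
    then have "\<bar>w x\<bar> * \<bar>D y (x - t *\<^sub>R y)\<bar> \<le> K * \<bar>w x\<bar>"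
      by (metis abs_ge_zero mult.commute mult_left_mono)
    moreover have "x \<in> ball 0 (r + 1 + 1)" using True inb by blast
    ultimately show ?thesis using True by (simp add: F_def abs_mult)
  next
    case False
    then have "F x t = 0" using K[of "x - t *\<^sub>R y"] by (auto simp: F_def)
    then show ?thesis using K0 by simp
  qed
  have ibox: "integrable lborel (\<lambda>t::real. indicator {0..1} t * c :: real)" for c
    by (intro integrable_mult_left integrable_real_indicator) auto
  have iw: "integrable lborel (\<lambda>x. indicator (ball 0 R) x * \<bar>w x\<bar>)" for R
    using set_integrable_abs[OF loc[of R]] by (simp add: set_integrable_def)
  have Fmeas[measurable]: "case_prod F \<in> borel_measurable (lborel \<Otimes>\<^sub>M lborel)"
    unfolding F_def by measurable
  have Fint_t: "integrable lborel (F x)" for x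
    by (rule Bochner_Integration.integrable_bound[of _ "\<lambda>t. indicator {0..1} t * (K * (indicator (ball 0 (r + 1 + 1)) x * \<bar>w x\<bar>))"])
       (use Fle[of x] in \<open>auto intro!: ibox AE_I2 simp: abs_mult mult_ac F_def K0\<close>)
  have "integrable (lborel \<Otimes>\<^sub>M lborel) (case_prod F)"
  proof (rule lborel_pair.Fubini_integrable[OF Fmeas])
    show "AE x in lborel. integrable lborel (\<lambda>t. case (x, t) of (x, t) \<Rightarrow> F x t)"
      using Fint_t by simp
    show "integrable lborel (\<lambda>x. \<integral>t. norm (case (x, t) of (x, t) \<Rightarrow> F x t) \<partial>lborel)"
    proof (rule Bochner_Integration.integrable_bound[OF integrable_mult_right[OF iw[of "r + 1 + 1"], of K]])
      show "(\<lambda>x. \<integral>t. norm (case (x, t) of (x, t) \<Rightarrow> F x t) \<partial>lborel) \<in> borel_measurable lborel"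
        by measurable
      have "(\<integral>t. \<bar>F x t\<bar> \<partial>lborel) \<le> K * (indicator (ball 0 (r + 1 + 1)) x * \<bar>w x\<bar>)" for x
      proof -
        have "(\<integral>t. \<bar>F x t\<bar> \<partial>lborel) \<le> (\<integral>t. indicator {0..1::real} t * (K * (indicator (ball 0 (r + 1 + 1)) x * \<bar>w x\<bar>)) \<partial>lborel)"
        proof (rule integral_mono[OF integrable_abs[OF Fint_t] ibox])
          show "\<bar>F x t\<bar> \<le> indicator {0..1} t * (K * (indicator (ball 0 (r + 1 + 1)) x * \<bar>w x\<bar>))" for t
            using Fle[of x t] by (simp add: mult_ac)
        qed
        then show ?thesis by (simp del: mult_eq_0_iff)
      qed
      then show "AE x in lborel. norm (\<integral>t. norm (case (x, t) of (x, t) \<Rightarrow> F x t) \<partial>lborel)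
          \<le> norm (K * (indicator (ball 0 (r + 1 + 1)) x * \<bar>w x\<bar>))"
        using K0 by (intro AE_I2) (simp add: abs_mult)
    qed
  qed
  from lborel_pair.Fubini_integral[OF this]
  have Fub: "(\<integral>t. (\<integral>x. F x t \<partial>lborel) \<partial>lborel) = (\<integral>x. (\<integral>t. F x t \<partial>lborel) \<partial>lborel)" .
  have inner_t: "(\<integral>t. F x t \<partial>lborel) = - (w x * (\<psi> (x - y) - \<psi> x))" for x
  proof -
    have deriv: "((\<lambda>t. \<psi> (x - t *\<^sub>R y)) has_vector_derivative - D y (x - t *\<^sub>R y)) (at t within {0..1})" for t
    proof -
      have 1: "((\<lambda>t. x - t *\<^sub>R y) has_derivative (\<lambda>s. - (s *\<^sub>R y))) (at t within {0..1})"
        by (auto intro!: derivative_eq_intros)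
      interpret linear "frechet_derivative \<psi> (at (x - t *\<^sub>R y))"
        using test_fun_has_derivative[OF \<psi>(1)] has_derivative_linear by blast
      from has_derivative_compose[OF 1 test_fun_has_derivative[OF \<psi>(1)]] show ?thesis
        by (simp add: has_vector_derivative_def neg scale D_def)
    qed
    have "(LBINT t:{0..1}. - D y (x - t *\<^sub>R y)) = \<psi> (x - 1 *\<^sub>R y) - \<psi> (x - 0 *\<^sub>R y)"
      unfolding set_lebesgue_integral_def
    proof (rule integral_FTC_Icc)
      show "continuous_on {0..1} (\<lambda>t. - D y (x - t *\<^sub>R y))"
        by (intro continuous_intros continuous_on_compose2[OF Dcont]) auto
    qed (use deriv in auto)
    then have "(LBINT t:{0..1}. D y (x - t *\<^sub>R y)) = - (\<psi> (x - y) - \<psi> x)"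
      by (simp add: set_lebesgue_integral_def)
    then have "w x * (\<integral>t. indicator {0..1} t * D y (x - t *\<^sub>R y) \<partial>lborel) = - (w x * (\<psi> (x - y) - \<psi> x))"
      by (simp add: set_lebesgue_integral_def right_diff_distrib)
    moreover have "(\<integral>t. F x t \<partial>lborel) = (\<integral>t. w x * (indicator {0..1} t * D y (x - t *\<^sub>R y)) \<partial>lborel)"
      by (simp add: F_def mult_ac)
    ultimately show ?thesis by simp
  qed
  have inner_x: "\<bar>\<integral>x. F x t \<partial>lborel\<bar> \<le> indicator {0..1} t * (DIM('a) * C * norm y)" for t
  proof (cases "t \<in> {0..1}")
    case True
    \<comment> \<open>A shift by at most 1 keeps the support inside the ball of radius
      \<open>r + 1\<close>, so \<open>\<phi>\<close> is admissible in the hypothesis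
      \<open>C\<close>; this is why that hypothesis has the larger radius.\<close>
    define \<phi> where "\<phi> x = \<psi> (x + - (t *\<^sub>R y))" for x
    have \<phi>: "test_fun \<phi>" unfolding \<phi>_def by (rule test_fun_translate[OF \<psi>(1)])
    have \<phi>_out: "\<phi> x = 0" if "x \<notin> ball 0 (r + 1)" for x
      unfolding \<phi>_def by (rule \<psi>(3)) (use inb[OF _ True, of x r] that in auto)
    have \<phi>_D: "frechet_derivative \<phi> (at x) b = D b (x - t *\<^sub>R y)" for x b
    proof -
      have "((\<lambda>x. x + - (t *\<^sub>R y)) has_derivative (\<lambda>v. v)) (at x)"
        by (auto intro!: derivative_eq_intros)
      from has_derivative_compose[OF this test_fun_has_derivative[OF \<psi>(1)]]
      have "(\<phi> has_derivative frechet_derivative \<psi> (at (x - t *\<^sub>R y))) (at x)"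
        by (simp add: \<phi>_def[abs_def])
      then show ?thesis using frechet_derivative_at unfolding D_def by metis
    qed
    have le: "\<bar>\<integral>x. w x * D b (x - t *\<^sub>R y) \<partial>lborel\<bar> \<le> C" if "b \<in> Basis" for b
      using C[OF \<phi> _ \<phi>_out that] \<psi>(2) by (simp add: \<phi>_D) (simp add: \<phi>_def)
    have int: "integrable lborel (\<lambda>x. w x * D b (x - t *\<^sub>R y))" for b
    proof -
      obtain K' where "\<And>x. \<bar>D b (x - t *\<^sub>R y)\<bar> \<le> K' * indicator (ball 0 (r + 1 + 1)) x"
        using test_fun_derivative_bounded[OF \<phi> \<phi>_out] unfolding \<phi>_D by blast
      then show ?thesis by (intro integrable_mult_bounded_support_lborel[OF loc w]) auto
    qed
    have "(\<integral>x. F x t \<partial>lborel) = (\<integral>x. (\<Sum>b\<in>Basis. (y \<bullet> b) * (w x * D b (x - t *\<^sub>R y))) \<partial>lborel)"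
      using True by (simp add: F_def Dlin sum_distrib_left mult_ac)
    also have "\<dots> = (\<Sum>b\<in>Basis. (y \<bullet> b) * (\<integral>x. w x * D b (x - t *\<^sub>R y) \<partial>lborel))"
      using int by (subst Bochner_Integration.integral_sum) auto
    also have "\<bar>\<dots>\<bar> \<le> (\<Sum>b\<in>(Basis::'a set). norm y * C)"
      by (rule order_trans[OF sum_abs], rule sum_mono, unfold abs_mult)
         (intro mult_mono le Basis_le_norm norm_ge_zero abs_ge_zero, simp_all)
    finally show ?thesis using True by (simp add: mult_ac)
  qed (simp add: F_def)
  have "\<bar>\<integral>t. (\<integral>x. F x t \<partial>lborel) \<partial>lborel\<bar> \<le> (\<integral>t. indicator {0..1::real} t * (DIM('a) * C * norm y) \<partial>lborel)"
  proof (rule integral_abs_bound_integral[OF _ ibox inner_x])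
    have "(\<lambda>t. \<integral>x. F x t \<partial>lborel) \<in> borel_measurable lborel" by measurable
    then show "integrable lborel (\<lambda>t. \<integral>x. F x t \<partial>lborel)"
      by (rule Bochner_Integration.integrable_bound[OF ibox, of _ "DIM('a) * C * norm y"])
         (use inner_x in \<open>auto intro!: AE_I2 order_trans[OF _ abs_ge_self]\<close>)
  qed
  then show ?thesis by (simp add: Fub inner_t)
qed

text \<open>By duality it suffices to test the difference against \<open>\<psi>\<close>. A change of
  variables moves the translation onto the test function, where smoothness makes the difference of
  order \<open>norm y\<close>.\<close>

lemma translation_estimate:
  fixes w :: "'a::euclidean_space \<Rightarrow> real" and r C :: real
  assumes w[measurable]: "w \<in> borel_measurable borel" and loc: "\<And>r. set_integrable lborel (ball 0 r) w"
    and r: "0 < r" and y: "norm y \<le> 1"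
    and C: "\<And>\<phi> b. test_fun \<phi> \<Longrightarrow> (\<And>x. \<bar>\<phi> x\<bar> \<le> 1) \<Longrightarrow> (\<And>x. x \<notin> ball 0 (r + 1) \<Longrightarrow> \<phi> x = 0)
      \<Longrightarrow> b \<in> Basis \<Longrightarrow> \<bar>\<integral>x. w x * frechet_derivative \<phi> (at x) b \<partial>lborel\<bar> \<le> C"
  shows "(LINT x:ball 0 r|lborel. \<bar>w (x + y) - w x\<bar>) \<le> DIM('a) * C * norm y"
proof (rule set_integral_abs_le_of_test_fun[OF _ _ r])
  show "set_integrable lborel (ball 0 r) (\<lambda>x. w (x + y) - w x)"
    by (intro set_integral_diff loc set_integrable_translate)
  fix \<psi> :: "'a \<Rightarrow> real"
  assume \<psi>: "test_fun \<psi>" "\<And>x. \<bar>\<psi> x\<bar> \<le> 1" "\<And>x. x \<notin> ball 0 r \<Longrightarrow> \<psi> x = 0"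
  have [measurable]: "\<psi> \<in> borel_measurable borel"
    by (intro borel_measurable_continuous_onI test_fun_continuous \<psi>)
  have 1: "integrable lborel (\<lambda>x. w x * \<psi> x)"
    by (rule integrable_mult_bounded_support_lborel[OF loc[of r] w, of _ 1]) (use \<psi> in \<open>auto simp: indicator_def\<close>)
  have 2: "integrable lborel (\<lambda>x. w x * \<psi> (x - y))"
  proof (rule integrable_mult_bounded_support_lborel[OF loc[of "r + 1"] w, of _ 1])
    show "\<bar>\<psi> (x - y)\<bar> \<le> 1 * indicator (ball 0 (r + 1)) x" for x
      using \<psi>(2,3)[of "x - y"] norm_triangle_ineq[of "x - y" y] y by (auto simp: indicator_def)
  qed simp
  have 3: "integrable lborel (\<lambda>x. w (x + y) * \<psi> x)"
    by (rule integrable_mult_bounded_support_lborel[where E = "ball 0 r" and K = 1])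
       (use \<psi> in \<open>auto simp: indicator_def intro!: set_integrable_translate loc\<close>)
  have "(\<integral>x. (w (x + y) - w x) * \<psi> x \<partial>lborel) = (\<integral>x. w (x + y) * \<psi> (x + y - y) \<partial>lborel) - (\<integral>x. w x * \<psi> x \<partial>lborel)"
    using 1 3 by (simp add: left_diff_distrib)
  also have "\<dots> = (\<integral>x. w x * \<psi> (x - y) \<partial>lborel) - (\<integral>x. w x * \<psi> x \<partial>lborel)"
    by (subst lborel_integral_translate[where f = "\<lambda>x. w x * \<psi> (x - y)"]) auto
  also have "\<dots> = (\<integral>x. w x * (\<psi> (x - y) - \<psi> x) \<partial>lborel)"
    using 1 2 by (simp add: right_diff_distrib)
  finally have eq: "(\<integral>x. (w (x + y) - w x) * \<psi> x \<partial>lborel) = \<dots>" .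
  show "\<bar>\<integral>x. (w (x + y) - w x) * \<psi> x \<partial>lborel\<bar> \<le> DIM('a) * C * norm y"
    unfolding eq by (rule translation_test_estimate[where r = r, OF w loc \<psi> y C])
qed simp

section \<open>Functions compared with their averages over small balls\<close>

lemma ball_in_borel [measurable]: "ball (c::'a::metric_space) r \<in> sets borel"
  by simp

text \<open>With a fixed domain of integration and the centre inside the integrand, the left form
  makes measurability in \<open>x\<close> evident.\<close>

lemma set_integral_ball_translate:
  fixes w :: "'a::euclidean_space \<Rightarrow> real"
  assumes [measurable]: "w \<in> borel_measurable borel"
  shows "(\<integral>y. indicator (ball 0 h) y * w (x + y) \<partial>lborel) = (LINT z:ball x h|lborel. w z)"
proof -
  have "(\<integral>y. indicator (ball 0 h) y * w (x + y) \<partial>lborel) = (\<integral>y. indicator (ball x h) (y + x) * w (y + x) \<partial>lborel)"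
    by (intro Bochner_Integration.integral_cong) (auto simp: indicator_def dist_norm add.commute)
  also have "\<dots> = (LINT z:ball x h|lborel. w z)"
    by (subst lborel_integral_translate) (simp_all add: set_lebesgue_integral_def)
  finally show ?thesis .
qed

text \<open>With V the volume of the small ball and A(x) the integral of w over its translate to x,
  V w(x) is A(x) minus the integral of w(x+y) - w(x) over |y| < h. Taking absolute values,
  integrating over x and exchanging the integrals by Tonelli bounds the last term by V C. Everything
  stays multiplied by V to avoid divisions.\<close>

lemma L1_le_translation_modulus:
  fixes w :: "'a::euclidean_space \<Rightarrow> real"
  assumes w[measurable]: "w \<in> borel_measurable borel" and loc: "\<And>r. set_integrable lborel (ball 0 r) w"
    and h: "0 < h" and C0: "0 \<le> C"
    and mod: "\<And>y. norm y < h \<Longrightarrow> (LINT x:ball 0 r|lborel. \<bar>w (x + y) - w x\<bar>) \<le> C"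
  shows "measure lborel (ball (0::'a) h) * (LINT x:ball 0 r|lborel. \<bar>w x\<bar>)
    \<le> measure lborel (ball (0::'a) h) * C + (LINT x:ball 0 r|lborel. \<bar>LINT z:ball x h|lborel. w z\<bar>)"
proof -
  let ?B = "ball (0::'a) r" and ?H = "ball (0::'a) h"
  define V where "V = measure lborel ?H"
  have emV: "emeasure lborel ?H = ennreal V" unfolding V_def
    by (rule emeasure_eq_ennreal_measure) (use emeasure_lborel_ball_finite[of "0::'a" h] in auto)
  have V0: "0 \<le> V" by (simp add: V_def)
  define A where "A x = (\<integral>y. indicator ?H y * w (x + y) \<partial>lborel)" for x
  have A_eq: "A x = (LINT z:ball x h|lborel. w z)" for x
    unfolding A_def by (rule set_integral_ball_translate[OF w])
  have [measurable]: "A \<in> borel_measurable borel" unfolding A_def by measurable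
  have intw: "integrable lborel (\<lambda>y. indicator ?H y * w (x + y))" for x
    using set_integrable_translate[OF loc, of h x] by (simp add: set_integrable_def add.commute)
  have intH: "integrable lborel (\<lambda>y. indicator ?H y * c :: real)" for c
    using emeasure_lborel_ball_finite[of "0::'a" h] by (intro integrable_mult_left integrable_real_indicator) auto
  define D where "D x y = ennreal \<bar>w (x + y) - w x\<bar>" for x y
  have [measurable]: "case_prod D \<in> borel_measurable (lborel \<Otimes>\<^sub>M lborel)"
    unfolding D_def by measurable
  have ptw: "ennreal V * ennreal \<bar>w x\<bar> \<le> ennreal \<bar>A x\<bar> + (\<integral>\<^sup>+y\<in>?H. D x y \<partial>lborel)" for x
  proof -
    have i: "integrable lborel (\<lambda>y. indicator ?H y * (w (x + y) - w x))"
      using Bochner_Integration.integrable_diff[OF intw[of x] intH[of "w x"]] by (simp add: right_diff_distrib)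
    have "V * w x = (\<integral>y. indicator ?H y * w x \<partial>lborel)"
      by (simp add: V_def)
    also have "\<dots> = A x - (\<integral>y. indicator ?H y * (w (x + y) - w x) \<partial>lborel)"
      using intw[of x] intH[of "w x"] by (simp add: A_def right_diff_distrib)
    finally have "\<bar>V * w x\<bar> \<le> \<bar>A x\<bar> + \<bar>\<integral>y. indicator ?H y * (w (x + y) - w x) \<partial>lborel\<bar>"
      by linarith
    also have "\<dots> \<le> \<bar>A x\<bar> + (\<integral>y. \<bar>indicator ?H y * (w (x + y) - w x)\<bar> \<partial>lborel)"
      by (intro add_left_mono integral_abs_bound)
    finally have "V * \<bar>w x\<bar> \<le> \<bar>A x\<bar> + (\<integral>y. \<bar>indicator ?H y * (w (x + y) - w x)\<bar> \<partial>lborel)"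
      using V0 by (simp add: abs_mult)
    then have "ennreal (V * \<bar>w x\<bar>) \<le> ennreal (\<bar>A x\<bar> + (\<integral>y. \<bar>indicator ?H y * (w (x + y) - w x)\<bar> \<partial>lborel))"
      by (rule ennreal_leI)
    also have "\<dots> = ennreal \<bar>A x\<bar> + (\<integral>\<^sup>+y. ennreal \<bar>indicator ?H y * (w (x + y) - w x)\<bar> \<partial>lborel)"
      using integrable_abs[OF i] by (subst ennreal_plus) (auto intro: integral_nonneg_AE simp: nn_integral_eq_integral)
    also have "(\<integral>\<^sup>+y. ennreal \<bar>indicator ?H y * (w (x + y) - w x)\<bar> \<partial>lborel) = (\<integral>\<^sup>+y\<in>?H. D x y \<partial>lborel)"
      by (intro nn_integral_cong) (auto simp: D_def indicator_def)
    finally show ?thesis using V0 by (simp add: ennreal_mult')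
  qed
  have inner: "(\<integral>\<^sup>+x\<in>?B. D x y \<partial>lborel) \<le> ennreal C" if "y \<in> ?H" for y
  proof -
    have "set_integrable lborel ?B (\<lambda>x. \<bar>w (x + y) - w x\<bar>)"
      by (intro set_integrable_abs set_integral_diff loc set_integrable_translate)
    then have "(\<integral>\<^sup>+x. ennreal (indicator ?B x *\<^sub>R \<bar>w (x + y) - w x\<bar>) \<partial>lborel) = ennreal (LINT x:?B|lborel. \<bar>w (x + y) - w x\<bar>)"
      unfolding set_integrable_def set_lebesgue_integral_def by (rule nn_integral_eq_integral) auto
    also have "\<dots> \<le> ennreal C" using mod[of y] that by (intro ennreal_leI) simp
    finally show ?thesis
      by (rule order_trans[rotated]) (auto intro!: nn_integral_mono simp: D_def indicator_def)
  qed
  \<comment> \<open>On the ball of radius \<open>r\<close> the function \<open>A\<close> is bounded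
    by the integral of |w| over the ball of radius \<open>r + h\<close>. Integrability lets the
    final inequality between extended reals be read in the reals.\<close>
  have intA: "integrable lborel (\<lambda>x. indicator ?B x * \<bar>A x\<bar>)"
  proof (rule Bochner_Integration.integrable_bound[OF integrable_mult_right[where c = "LINT z:ball 0 (r + h)|lborel. \<bar>w z\<bar>"]])
    show "integrable lborel (indicat_real ?B)"
      using emeasure_lborel_ball_finite[of "0::'a" r] by (intro integrable_real_indicator) auto
    have "\<bar>A x\<bar> \<le> (LINT z:ball 0 (r + h)|lborel. \<bar>w z\<bar>)" if "x \<in> ?B" for x
    proof -
      have "norm z < r + h" if "norm (x - z) < h" for z
        using that \<open>x \<in> ?B\<close> norm_triangle_sub[of z x] by (simp add: norm_minus_commute)
      then have sub: "ball x h \<subseteq> ball 0 (r + h)" by (auto simp: dist_norm)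
      have "\<bar>A x\<bar> \<le> (LINT z:ball x h|lborel. \<bar>w z\<bar>)"
        unfolding A_eq set_lebesgue_integral_def by (rule order_trans[OF integral_abs_bound]) (simp add: abs_mult)
      also have "\<dots> \<le> (LINT z:ball 0 (r + h)|lborel. \<bar>w z\<bar>)"
        unfolding set_lebesgue_integral_def
      proof (rule integral_mono)
        show "integrable lborel (\<lambda>z. indicat_real (ball x h) z *\<^sub>R \<bar>w z\<bar>)"
          using set_integrable_abs[OF set_integrable_subset[OF loc _ sub]] by (simp add: set_integrable_def)
        show "integrable lborel (\<lambda>z. indicat_real (ball 0 (r + h)) z *\<^sub>R \<bar>w z\<bar>)"
          using set_integrable_abs[OF loc] by (simp add: set_integrable_def)
      qed (use sub in \<open>auto simp: indicator_def\<close>)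
      finally show ?thesis .
    qed
    then show "AE x in lborel. norm (indicator ?B x * \<bar>A x\<bar>) \<le> norm ((LINT z:ball 0 (r + h)|lborel. \<bar>w z\<bar>) * indicat_real ?B x)"
      by (intro AE_I2) (auto simp: indicator_def intro: order_trans[OF _ abs_ge_self])
  qed measurable
  have intw': "integrable lborel (\<lambda>x. indicator ?B x * \<bar>w x\<bar>)"
    using set_integrable_abs[OF loc[of r]] by (simp add: set_integrable_def)
  have "(\<integral>\<^sup>+x. (\<integral>\<^sup>+y\<in>?H. D x y \<partial>lborel) * indicator ?B x \<partial>lborel)
      = (\<integral>\<^sup>+x. (\<integral>\<^sup>+y. D x y * indicator ?H y * indicator ?B x \<partial>lborel) \<partial>lborel)"
    by (subst nn_integral_multc[symmetric]) auto
  also have "\<dots> = (\<integral>\<^sup>+y. (\<integral>\<^sup>+x. D x y * indicator ?H y * indicator ?B x \<partial>lborel) \<partial>lborel)"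
    by (rule lborel_pair.Fubini'[symmetric]) measurable
  also have "\<dots> = (\<integral>\<^sup>+y. (\<integral>\<^sup>+x\<in>?B. D x y \<partial>lborel) * indicator ?H y \<partial>lborel)"
    by (subst nn_integral_multc[symmetric]) (auto simp: mult_ac)
  also have "\<dots> \<le> (\<integral>\<^sup>+y. ennreal C * indicator ?H y \<partial>lborel)"
    using inner by (intro nn_integral_mono) (auto simp: indicator_def)
  also have "\<dots> = ennreal (V * C)"
    using C0 V0 by (simp add: nn_integral_cmult_indicator emV ennreal_mult' mult.commute)
  finally have rem: "(\<integral>\<^sup>+x. (\<integral>\<^sup>+y\<in>?H. D x y \<partial>lborel) * indicator ?B x \<partial>lborel) \<le> ennreal (V * C)" .
  have "ennreal V * (\<integral>\<^sup>+x\<in>?B. ennreal \<bar>w x\<bar> \<partial>lborel) = (\<integral>\<^sup>+x. (ennreal V * ennreal \<bar>w x\<bar>) * indicator ?B x \<partial>lborel)"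
    by (subst nn_integral_cmult[symmetric]) (auto simp: mult_ac)
  also have "\<dots> \<le> (\<integral>\<^sup>+x. ennreal \<bar>A x\<bar> * indicator ?B x + (\<integral>\<^sup>+y\<in>?H. D x y \<partial>lborel) * indicator ?B x \<partial>lborel)"
    using ptw by (intro nn_integral_mono) (auto simp: indicator_def)
  also have "\<dots> = (\<integral>\<^sup>+x\<in>?B. ennreal \<bar>A x\<bar> \<partial>lborel) + (\<integral>\<^sup>+x. (\<integral>\<^sup>+y\<in>?H. D x y \<partial>lborel) * indicator ?B x \<partial>lborel)"
    by (rule nn_integral_add) measurable
  also have "\<dots> \<le> (\<integral>\<^sup>+x\<in>?B. ennreal \<bar>A x\<bar> \<partial>lborel) + ennreal (V * C)"
    by (rule add_left_mono[OF rem])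
  also have "(\<integral>\<^sup>+x\<in>?B. ennreal \<bar>w x\<bar> \<partial>lborel) = ennreal (\<integral>x. indicator ?B x * \<bar>w x\<bar> \<partial>lborel)"
    by (subst nn_integral_eq_integral[OF intw', symmetric]) (auto intro!: nn_integral_cong simp: indicator_def)
  also have "(\<integral>\<^sup>+x\<in>?B. ennreal \<bar>A x\<bar> \<partial>lborel) = ennreal (\<integral>x. indicator ?B x * \<bar>A x\<bar> \<partial>lborel)"
    by (subst nn_integral_eq_integral[OF intA, symmetric]) (auto intro!: nn_integral_cong simp: indicator_def)
  finally have le: "ennreal V * ennreal (\<integral>x. indicator ?B x * \<bar>w x\<bar> \<partial>lborel)
      \<le> ennreal (\<integral>x. indicator ?B x * \<bar>A x\<bar> \<partial>lborel) + ennreal (V * C)" .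
  have A0: "0 \<le> (\<integral>x. indicator ?B x * \<bar>A x\<bar> \<partial>lborel)"
    by (rule integral_nonneg_AE) auto
  have VC0: "0 \<le> V * C" using V0 C0 by simp
  have "V * (\<integral>x. indicator ?B x * \<bar>w x\<bar> \<partial>lborel) \<le> (\<integral>x. indicator ?B x * \<bar>A x\<bar> \<partial>lborel) + V * C"
    using le unfolding ennreal_mult'[OF V0, symmetric] ennreal_plus[OF A0 VC0, symmetric]
    by (subst (asm) ennreal_le_iff) (use A0 VC0 in auto)
  then show ?thesis by (simp add: set_lebesgue_integral_def V_def A_eq add.commute)
qed

text \<open>The uniform modulus fixes a scale \<open>h\<close>, independent of \<open>k\<close>, at
  which averaging costs at most \<open>e / 2\<close>. At this fixed scale the averages are bounded
  in \<open>k\<close> and \<open>x\<close> and tend to 0 pointwise, so dominated convergence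
  finishes.\<close>

lemma L1_ball_convergence:
  fixes w :: "nat \<Rightarrow> 'a::euclidean_space \<Rightarrow> real"
  assumes w[measurable]: "\<And>k. w k \<in> borel_measurable borel"
    and loc: "\<And>k r. set_integrable lborel (ball 0 r) (w k)"
    and mod: "\<And>k y. norm y \<le> 1 \<Longrightarrow> (LINT x:ball 0 r|lborel. \<bar>w k (x + y) - w k x\<bar>) \<le> C * norm y"
    and lim: "\<And>x h. 0 < h \<Longrightarrow> (\<lambda>k. LINT z:ball x h|lborel. w k z) \<longlonglongrightarrow> 0"
    and bnd: "\<And>h. 0 < h \<Longrightarrow> \<exists>K. \<forall>k x. \<bar>LINT z:ball x h|lborel. w k z\<bar> \<le> K"
  shows "(\<lambda>k. LINT x:ball 0 r|lborel. \<bar>w k x\<bar>) \<longlonglongrightarrow> 0"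
proof (rule LIMSEQ_I)
  fix e :: real assume e: "0 < e"
  \<comment> \<open>The minimum is there because \<open>mod\<close> covers only shifts of norm at
    most 1; \<open>\<bar>C\<bar> + 1\<close> keeps the denominator positive for every
    \<open>C\<close>.\<close>
  define h where "h = min 1 (e / (2 * (\<bar>C\<bar> + 1)))"
  have h: "0 < h" "h \<le> 1" using e by (auto simp: h_def)
  have Ch: "\<bar>C\<bar> * h \<le> e / 2"
  proof -
    have "\<bar>C\<bar> * h \<le> (\<bar>C\<bar> + 1) * (e / (2 * (\<bar>C\<bar> + 1)))"
      using h by (intro mult_mono) (auto simp: h_def)
    also have "\<dots> = e / 2"
    proof -
      have "\<bar>C\<bar> + 1 \<noteq> 0" by linarith
      then show ?thesis by (simp add: divide_simps)
    qed
    finally show ?thesis .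
  qed
  have mod': "(LINT x:ball 0 r|lborel. \<bar>w k (x + y) - w k x\<bar>) \<le> e / 2" if "norm y < h" for k y
  proof -
    have "C * norm y \<le> \<bar>C\<bar> * h" using that by (intro mult_mono) auto
    with mod[of y k] Ch h that show ?thesis by simp
  qed
  let ?V = "measure lborel (ball (0::'a) h)"
  have V: "?V > 0" using content_ball_pos[OF h(1)] by simp
  define A where "A k x = (LINT z:ball x h|lborel. w k z)" for k x
  have [measurable]: "A k \<in> borel_measurable borel" for k
    unfolding A_def set_integral_ball_translate[OF w, symmetric] by measurable
  obtain K where K: "\<And>k x. \<bar>A k x\<bar> \<le> K" using bnd[OF h(1)] unfolding A_def by blast
  have "(\<lambda>k. \<integral>x. indicator (ball 0 r) x *\<^sub>R \<bar>A k x\<bar> \<partial>lborel) \<longlonglongrightarrow> (\<integral>x. 0 \<partial>(lborel :: 'a measure))"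
  proof (rule integral_dominated_convergence[where w = "\<lambda>x. indicator (ball 0 r) x * K"])
    show "integrable lborel (\<lambda>x::'a. indicator (ball 0 r) x * K)"
      using emeasure_lborel_ball_finite[of "0::'a" r] by (intro integrable_mult_left integrable_real_indicator) auto
    show "AE x in lborel. (\<lambda>k. indicator (ball 0 r) x *\<^sub>R \<bar>A k x\<bar>) \<longlonglongrightarrow> 0"
      using tendsto_rabs_zero[OF lim[OF h(1)]]
      by (intro AE_I2) (auto simp: A_def indicator_def)
    show "AE x in lborel. norm (indicator (ball 0 r) x *\<^sub>R \<bar>A k x\<bar>) \<le> indicator (ball 0 r) x * K" for k
      using K by (intro AE_I2) (auto simp: indicator_def)
  qed auto
  then have "(\<lambda>k. LINT x:ball 0 r|lborel. \<bar>A k x\<bar>) \<longlonglongrightarrow> 0" by (simp add: set_lebesgue_integral_def)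
  from LIMSEQ_D[OF this, of "?V * (e / 2)"] V e obtain N
    where N: "\<And>k. k \<ge> N \<Longrightarrow> \<bar>LINT x:ball 0 r|lborel. \<bar>A k x\<bar>\<bar> < ?V * (e / 2)" by auto
  have "\<bar>LINT x:ball 0 r|lborel. \<bar>w k x\<bar>\<bar> < e" if "k \<ge> N" for k
  proof -
    have "?V * (LINT x:ball 0 r|lborel. \<bar>w k x\<bar>) \<le> ?V * (e / 2) + (LINT x:ball 0 r|lborel. \<bar>A k x\<bar>)"
      unfolding A_def using e by (intro L1_le_translation_modulus w loc h(1) mod') auto
    also have "\<dots> < ?V * (e / 2) + ?V * (e / 2)" using N[OF that] by linarith
    also have "\<dots> = ?V * e" by (simp add: distrib_left[symmetric])
    finally have "(LINT x:ball 0 r|lborel. \<bar>w k x\<bar>) < e" using V by simp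
    moreover have "0 \<le> (LINT x:ball 0 r|lborel. \<bar>w k x\<bar>)"
      unfolding set_lebesgue_integral_def by (rule integral_nonneg_AE) auto
    ultimately show ?thesis by simp
  qed
  then show "\<exists>N. \<forall>k\<ge>N. norm ((LINT x:ball 0 r|lborel. \<bar>w k x\<bar>) - 0) < e" by auto
qed

subsection \<open>The maximal function\<close>

lemma ball_in_lebesgue [measurable]: "ball (c::'a::euclidean_space) r \<in> sets lebesgue"
  by simp

text \<open>Countable subadditivity with the sum written as an integral for the counting measure:
  the Vitali lemma delivers a countable set of balls without an enumeration.\<close>

lemma emeasure_UN_le_nn_integral:
  assumes [measurable]: "\<And>i. i \<in> I \<Longrightarrow> X i \<in> sets M" and I: "countable I"
  shows "emeasure M (\<Union>i\<in>I. X i) \<le> (\<integral>\<^sup>+i. emeasure M (X i) \<partial>count_space I)"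
proof -
  have "(\<Union>i\<in>I. X i) \<in> sets M" using I assms(1) by (intro sets.countable_UN') auto
  then have "emeasure M (\<Union>i\<in>I. X i) = (\<integral>\<^sup>+x. indicator (\<Union>i\<in>I. X i) x \<partial>M)"
    by simp
  also have "\<dots> \<le> (\<integral>\<^sup>+x. \<integral>\<^sup>+i. indicator (X i) x \<partial>count_space I \<partial>M)"
  proof (rule nn_integral_mono)
    fix x
    show "indicator (\<Union>i\<in>I. X i) x \<le> (\<integral>\<^sup>+i. indicator (X i) x \<partial>count_space I)"
    proof (cases "x \<in> (\<Union>i\<in>I. X i)")
      case True
      then obtain i where "i \<in> I" "x \<in> X i" by blast
      with nn_integral_ge_point[of i I "\<lambda>i. indicator (X i) x"] True show ?thesis by simp
    qed simp
  qed
  also have "\<dots> = (\<integral>\<^sup>+i. \<integral>\<^sup>+x. indicator (X i) x \<partial>M \<partial>count_space I)"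
    by (rule nn_integral_count_space_nn_integral[OF I]) measurable
  also have "\<dots> = (\<integral>\<^sup>+i. emeasure M (X i) \<partial>count_space I)"
    by (intro nn_integral_cong) simp
  finally show ?thesis .
qed

text \<open>Vitali selects disjoint balls among those whose average exceeds \<open>t\<close>, and
  their fivefold enlargements cover all bad centres. Taking \<open>U\<close> as the union of the
  enlargements makes it measurable whatever the set of bad centres is. The bound
  \<open>R \<le> m\<close> supplies the bounded radii that Vitali requires and keeps all balls
  inside \<open>ball 0 (2 * m)\<close>.\<close>

lemma weak_type_maximal:
  fixes w :: "'a::euclidean_space \<Rightarrow> real"
  assumes w: "w \<in> borel_measurable lebesgue" and loc: "set_integrable lebesgue (ball 0 (2 * m)) w"
    and l: "0 < t" and le: "(LINT x:ball 0 (2 * m)|lebesgue. \<bar>w x\<bar>) \<le> \<epsilon>"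
  obtains U where "U \<in> sets lebesgue" "emeasure lebesgue U \<le> ennreal (5 ^ DIM('a) * \<epsilon> / t)"
    "\<And>x R. x \<in> ball 0 m \<Longrightarrow> x \<notin> U \<Longrightarrow> 0 < R \<Longrightarrow> R \<le> m
      \<Longrightarrow> (\<integral>\<^sup>+y\<in>ball x R. ennreal \<bar>w y\<bar> \<partial>lebesgue) \<le> ennreal t * emeasure lebesgue (ball x R)"
proof -
  define I where "I x R = (\<integral>\<^sup>+y\<in>ball x R. ennreal \<bar>w y\<bar> \<partial>lebesgue)" for x R
  define K where "K = {(x, R). x \<in> ball 0 m \<and> 0 < R \<and> R \<le> m \<and> ennreal t * emeasure lebesgue (ball x R) < I x R}"
  define S where "S = fst ` K"
  have "S \<subseteq> (\<Union>i\<in>K. ball (fst i) (snd i))" by (force simp: S_def K_def)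
  moreover have "\<And>i. i \<in> K \<Longrightarrow> 0 < snd i \<and> snd i \<le> m" by (auto simp: K_def)
  ultimately obtain C where C: "countable C" "C \<subseteq> K"
    and disj: "pairwise (\<lambda>i j. disjnt (ball (fst i) (snd i)) (ball (fst j) (snd j))) C"
    and cov: "S \<subseteq> (\<Union>i\<in>C. ball (fst i) (5 * snd i))"
    by (rule Vitali_covering_lemma_balls)
  define U where "U = (\<Union>i\<in>C. ball (fst i) (5 * snd i))"
  have U: "U \<in> sets lebesgue"
    unfolding U_def by (rule sets.countable_UN'[OF C(1)]) auto
  have scale: "emeasure lebesgue (ball x (5 * R)) = ennreal (5 ^ DIM('a)) * emeasure lebesgue (ball x R)"
    if "0 < R" for x :: 'a and R
    using that emeasure_lebesgue_ball_conv_unit_ball[of "5 * R" x] emeasure_lebesgue_ball_conv_unit_ball[of R x]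
    by (simp add: power_mult_distrib ennreal_mult' mult.assoc)
  \<comment> \<open>As values of the measure with density |w|, the integrals over the disjoint balls
    add up by countable additivity.\<close>
  define \<nu> where "\<nu> = density lebesgue (\<lambda>y. ennreal \<bar>w y\<bar>)"
  have \<nu>: "emeasure \<nu> A = (\<integral>\<^sup>+y\<in>A. ennreal \<bar>w y\<bar> \<partial>lebesgue)" if "A \<in> sets lebesgue" for A
    unfolding \<nu>_def using that w by (intro emeasure_density) auto
  have sub: "(\<Union>i\<in>C. ball (fst i) (snd i)) \<subseteq> ball 0 (2 * m)"
  proof -
    have "ball x R \<subseteq> ball 0 (2 * m)" if "(x, R) \<in> K" for x R
    proof
      fix z assume "z \<in> ball x R"
      then show "z \<in> ball 0 (2 * m)" using that norm_triangle_sub[of z x]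
        by (auto simp: K_def dist_norm norm_minus_commute)
    qed
    then show ?thesis using C(2) by fastforce
  qed
  let ?b = "\<lambda>i. ball (fst i) (snd i) :: 'a set"
  have "ennreal t * emeasure lebesgue U \<le> ennreal t * (\<integral>\<^sup>+i. emeasure lebesgue (ball (fst i) (5 * snd i)) \<partial>count_space C)"
    unfolding U_def by (intro mult_left_mono emeasure_UN_le_nn_integral C(1)) auto
  also have "\<dots> = (\<integral>\<^sup>+i. ennreal t * emeasure lebesgue (ball (fst i) (5 * snd i)) \<partial>count_space C)"
    by (simp add: nn_integral_cmult)
  also have "\<dots> \<le> (\<integral>\<^sup>+i. ennreal (5 ^ DIM('a)) * emeasure \<nu> (?b i) \<partial>count_space C)"
  proof (rule nn_integral_mono)
    fix i assume "i \<in> space (count_space C)"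
    then have "i \<in> K" using C(2) by auto
    then obtain x R where i: "i = (x, R)" "0 < R" "ennreal t * emeasure lebesgue (ball x R) < I x R"
      by (auto simp: K_def)
    have "ennreal t * emeasure lebesgue (ball x (5 * R)) = ennreal (5 ^ DIM('a)) * (ennreal t * emeasure lebesgue (ball x R))"
      unfolding scale[OF i(2)] by (simp only: mult_ac)
    also have "\<dots> \<le> ennreal (5 ^ DIM('a)) * I x R"
      using i(3) by (intro mult_left_mono) auto
    finally show "ennreal t * emeasure lebesgue (ball (fst i) (5 * snd i)) \<le> ennreal (5 ^ DIM('a)) * emeasure \<nu> (?b i)"
      by (simp add: i(1) \<nu> I_def)
  qed
  also have "\<dots> = ennreal (5 ^ DIM('a)) * emeasure \<nu> (\<Union>i\<in>C. ?b i)"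
  proof -
    have "disjoint_family_on ?b C"
      using disj by (auto simp: disjoint_family_on_def pairwise_def disjnt_def)
    then have "emeasure \<nu> (\<Union>i\<in>C. ?b i) = (\<integral>\<^sup>+i. emeasure \<nu> (?b i) \<partial>count_space C)"
      by (intro emeasure_UN_countable C(1)) (auto simp: \<nu>_def)
    then show ?thesis by (simp add: nn_integral_cmult)
  qed
  also have "\<dots> \<le> ennreal (5 ^ DIM('a)) * emeasure \<nu> (ball 0 (2 * m))"
    using sub by (intro mult_left_mono emeasure_mono) (auto simp: \<nu>_def)
  also have "emeasure \<nu> (ball 0 (2 * m)) \<le> ennreal \<epsilon>"
  proof -
    have "integrable lebesgue (\<lambda>x. indicat_real (ball 0 (2 * m)) x *\<^sub>R \<bar>w x\<bar>)"
      using set_integrable_abs[OF loc] by (simp add: set_integrable_def)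
    then have "(\<integral>\<^sup>+x. ennreal (indicat_real (ball 0 (2 * m)) x *\<^sub>R \<bar>w x\<bar>) \<partial>lebesgue) = ennreal (LINT x:ball 0 (2 * m)|lebesgue. \<bar>w x\<bar>)"
      unfolding set_lebesgue_integral_def by (rule nn_integral_eq_integral) auto
    then have "emeasure \<nu> (ball 0 (2 * m)) = ennreal (LINT x:ball 0 (2 * m)|lebesgue. \<bar>w x\<bar>)"
      by (subst \<nu>) (auto intro!: nn_integral_cong simp: indicator_def elim!: trans[rotated])
    then show ?thesis using le by (simp add: ennreal_leI)
  qed
  finally have "ennreal t * emeasure lebesgue U \<le> ennreal (5 ^ DIM('a)) * ennreal \<epsilon>"
    by (simp add: mult_left_mono)
  then have "ennreal (1 / t) * (ennreal t * emeasure lebesgue U) \<le> ennreal (1 / t) * (ennreal (5 ^ DIM('a)) * ennreal \<epsilon>)"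
    by (intro mult_left_mono) auto
  moreover have "ennreal (1 / t) * (ennreal t * emeasure lebesgue U) = emeasure lebesgue U"
    using l by (simp add: mult.assoc[symmetric] ennreal_mult'[symmetric])
  moreover have "ennreal (1 / t) * (ennreal (5 ^ DIM('a)) * ennreal \<epsilon>) = ennreal (5 ^ DIM('a) * \<epsilon> / t)"
    using l by (simp add: ennreal_mult'[symmetric])
  ultimately have "emeasure lebesgue U \<le> ennreal (5 ^ DIM('a) * \<epsilon> / t)" by simp
  moreover have "I x R \<le> ennreal t * emeasure lebesgue (ball x R)"
    if "x \<in> ball 0 m" "x \<notin> U" "0 < R" "R \<le> m" for x R
  proof (rule ccontr)
    assume "\<not> ?thesis"
    then have "(x, R) \<in> K" using that by (simp add: K_def)
    then have "x \<in> S" by (force simp: S_def)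
    with that(2) cov show False unfolding U_def by blast
  qed
  ultimately show ?thesis using that[OF U] by (simp add: I_def)
qed

text \<open>The estimate |a - l| \<le> d is written as two sums because maximal functions may take
  the value \<open>top\<close>, where differences lose their meaning. For \<open>l = top\<close> any
  finite \<open>d j\<close> forces \<open>a j = top\<close>.\<close>

lemma tendsto_ennreal_sandwich:
  fixes a d :: "'b \<Rightarrow> ennreal"
  assumes "\<And>j. a j \<le> l + d j" "\<And>j. l \<le> a j + d j" and d: "(d \<longlongrightarrow> 0) F"
  shows "(a \<longlongrightarrow> l) F"
proof (cases "l = top")
  case True
  have "eventually (\<lambda>j. d j < 1) F" using order_tendstoD(2)[OF d, of 1] by simp
  then have "eventually (\<lambda>j. a j = l) F"
  proof eventually_elim
    case (elim j)
    then show ?case using assms(2)[of j] True by (cases "d j"; cases "a j") (auto simp: top_unique)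
  qed
  then show ?thesis by (rule tendsto_eventually)
next
  case False
  have 1: "((\<lambda>j. l - d j) \<longlongrightarrow> l - 0) F" by (intro tendsto_diff_ennreal tendsto_const d) (use False in auto)
  have 2: "((\<lambda>j. l + d j) \<longlongrightarrow> l + 0) F" by (intro tendsto_intros d)
  show ?thesis
  proof (rule tendsto_sandwich)
    show "\<forall>\<^sub>F j in F. l - d j \<le> a j"
      using assms(2) False by (intro always_eventually allI) (simp add: ennreal_minus_le_iff add.commute)
    show "\<forall>\<^sub>F j in F. a j \<le> l + d j" using assms(1) by simp
  qed (use 1 2 in simp_all)
qed

text \<open>Domination instead of an equation \<open>f = g + h\<close> lets one lemma give both
  halves of the sandwich: |u_k| \<le> |u| + |w_k| and |u| \<le> |u_k| + |w_k|.\<close>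

lemma maximal_fun_mono_add:
  fixes f g h :: "'a::euclidean_space \<Rightarrow> real"
  assumes "g \<in> borel_measurable lebesgue" "h \<in> borel_measurable lebesgue"
    and "\<And>x. \<bar>f x\<bar> \<le> \<bar>g x\<bar> + \<bar>h x\<bar>"
  shows "maximal_fun f x \<le> maximal_fun g x + maximal_fun h x"
  unfolding maximal_fun_def
proof (rule SUP_least)
  fix R :: real assume R: "R \<in> {0<..}"
  let ?B = "ball x R"
  have "(\<integral>\<^sup>+ y\<in>?B. ennreal \<bar>f y\<bar> \<partial>lebesgue) \<le> (\<integral>\<^sup>+ y. ennreal \<bar>g y\<bar> * indicator ?B y + ennreal \<bar>h y\<bar> * indicator ?B y \<partial>lebesgue)"
    using assms(3) by (intro nn_integral_mono) (auto simp: indicator_def ennreal_plus[symmetric] simp del: ennreal_plus intro: ennreal_leI)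
  also have "\<dots> = (\<integral>\<^sup>+ y\<in>?B. ennreal \<bar>g y\<bar> \<partial>lebesgue) + (\<integral>\<^sup>+ y\<in>?B. ennreal \<bar>h y\<bar> \<partial>lebesgue)"
    by (rule nn_integral_add; use assms(1,2) in measurable)
  finally have "(\<integral>\<^sup>+ y\<in>?B. ennreal \<bar>f y\<bar> \<partial>lebesgue) / emeasure lebesgue ?B
      \<le> (\<integral>\<^sup>+ y\<in>?B. ennreal \<bar>g y\<bar> \<partial>lebesgue) / emeasure lebesgue ?B
        + (\<integral>\<^sup>+ y\<in>?B. ennreal \<bar>h y\<bar> \<partial>lebesgue) / emeasure lebesgue ?B"
    by (simp add: divide_right_mono_ennreal add_divide_distrib_ennreal[symmetric])
  also have "\<dots> \<le> (SUP R\<in>{0<..}. (\<integral>\<^sup>+ y\<in>ball x R. ennreal \<bar>g y\<bar> \<partial>lebesgue) / emeasure lebesgue (ball x R))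
     + (SUP R\<in>{0<..}. (\<integral>\<^sup>+ y\<in>ball x R. ennreal \<bar>h y\<bar> \<partial>lebesgue) / emeasure lebesgue (ball x R))"
    using R by (intro add_mono SUP_upper)
  finally show "(\<integral>\<^sup>+ y\<in>?B. ennreal \<bar>f y\<bar> \<partial>lebesgue) / emeasure lebesgue ?B \<le> \<dots>" .
qed

subsection \<open>Weakly convergent sequences\<close>

text \<open>The averaging argument treats w(x + y) as a function measurable on a product of
  \<open>lborel\<close> with itself, which a Borel representative guarantees.\<close>

lemma borel_version:
  fixes f :: "'a::euclidean_space \<Rightarrow> real"
  assumes "f \<in> borel_measurable lebesgue"
  obtains f' where "f' \<in> borel_measurable borel" "AE x in lebesgue. f x = f' x"
proof -
  obtain f' where "f' \<in> borel_measurable lborel" "AE x in lborel. f x = f' x"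
    using completion_ex_borel_measurable_real[OF assms] by blast
  then show ?thesis using that[of f'] by (auto dest: AE_completion)
qed

lemma
  fixes f f' :: "'a::euclidean_space \<Rightarrow> real"
  assumes "f \<in> borel_measurable lebesgue" and f': "f' \<in> borel_measurable borel"
    and "AE x in lebesgue. f x = f' x"
  shows integral_lebesgue_eq_lborel: "integral\<^sup>L lebesgue f = integral\<^sup>L lborel f'"
    and integrable_lebesgue_imp_lborel: "integrable lebesgue f \<Longrightarrow> integrable lborel f'"
proof -
  have f'_leb: "f' \<in> borel_measurable lebesgue" using f' by (intro measurable_completion) simp
  have "integral\<^sup>L lebesgue f = integral\<^sup>L lebesgue f'"
    by (rule integral_cong_AE[OF assms(1) f'_leb assms(3)])
  also have "\<dots> = integral\<^sup>L lborel f'" using f' by (intro integral_completion) simp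
  finally show "integral\<^sup>L lebesgue f = integral\<^sup>L lborel f'" .
  show "integrable lborel f'" if "integrable lebesgue f"
  proof -
    have "integrable lebesgue f'"
      using integrable_cong_AE[OF assms(1) f'_leb assms(3)] that by simp
    then show ?thesis using f' by (simp add: integrable_completion)
  qed
qed

locale weakly_convergent =
  fixes p :: real and us :: "nat \<Rightarrow> 'a::euclidean_space \<Rightarrow> real" and u :: "'a \<Rightarrow> real"
  assumes p: "1 < p" and conv: "sobolev_weak_conv p us u"
begin

definition w :: "nat \<Rightarrow> 'a \<Rightarrow> real" where "w k x = us k x - u x"

lemma us: "us k \<in> sobolev p" and u: "u \<in> sobolev p"
  using conv by (simp_all add: sobolev_weak_conv_def)

lemma us_measurable: "us k \<in> borel_measurable lebesgue" and u_measurable: "u \<in> borel_measurable lebesgue"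
  using us[of k] u by (simp_all add: sobolev_def Lp_def)

lemma w_measurable: "w k \<in> borel_measurable lebesgue"
  using us_measurable u_measurable unfolding w_def[abs_def] by (rule borel_measurable_diff)

lemma w_loc: "set_integrable lebesgue (ball c r) (w k)"
proof -
  have "set_integrable lebesgue (ball c r) (\<lambda>x. us k x - u x)"
    using us[of k] u by (intro set_integral_diff Lp_set_integrable[OF p]) (auto simp: sobolev_def)
  then show ?thesis by (simp add: w_def[abs_def])
qed

text \<open>Weak convergence yields statements on the difference of two pairings; this turns them
  into statements on \<open>w k\<close>.\<close>

lemma pairing_diff:
  assumes "integrable lebesgue (\<lambda>x. us k x * g x)" "integrable lebesgue (\<lambda>x. u x * g x)"
  shows "(\<integral>x. w k x * g x \<partial>lebesgue) = (\<integral>x. us k x * g x \<partial>lebesgue) - (\<integral>x. u x * g x \<partial>lebesgue)"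
  using assms by (simp add: w_def left_diff_distrib)

text \<open>For a ball of radius \<open>R\<close> this bounds the average of |w_k| by a multiple of
  R^(-n/p), with one constant for all centres, radii and \<open>k\<close>; that uniformity is what
  later controls every large radius at once.\<close>

lemma average_bound:
  obtains C where "0 \<le> C" "\<And>k c R. 0 < R \<Longrightarrow>
    (LINT x:ball c R|lebesgue. \<bar>w k x\<bar>) \<le> C * measure lebesgue (ball c R) powr (1 - 1 / p)"
proof -
  \<comment> \<open>The factor |B|^(1/p - 1) normalises \<open>g\<close> in the dual exponent, so
    each pairing is at most \<open>2 * sobolev_norm p v\<close>, for every ball. All balls thus
    belong to one family.\<close>
  define G :: "('a \<Rightarrow> real) set" where "G = {g \<in> borel_measurable lebesgue. \<exists>c R. 0 < R \<and>
     (\<forall>x. \<bar>g x\<bar> \<le> measure lebesgue (ball c R) powr (1 / p - 1) * indicator (ball c R) x)}"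
  have G: "integrable lebesgue (\<lambda>x. v x * g x)"
    "\<bar>\<integral>x. v x * g x \<partial>lebesgue\<bar> \<le> 2 * sobolev_norm p v" if v: "v \<in> sobolev p" and g: "g \<in> G" for v g
  proof -
    from g obtain c R where g: "g \<in> borel_measurable lebesgue" and R: "0 < R"
      and le: "\<And>x. \<bar>g x\<bar> \<le> measure lebesgue (ball c R) powr (1 / p - 1) * indicator (ball c R) x"
      by (auto simp: G_def)
    note * = bounded_support_pairing[OF p v R powr_ge_zero g le]
    show "integrable lebesgue (\<lambda>x. v x * g x)" by (rule *(1))
    have "measure lebesgue (ball c R) \<noteq> 0" using content_ball_pos[OF R, of c] by simp
    then have "measure lebesgue (ball c R) powr (1 / p - 1) * (2 * measure lebesgue (ball c R) powr (1 - 1 / p)) = 2"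
      by (simp add: powr_add[symmetric])
    with *(2) show "\<bar>\<integral>x. v x * g x \<partial>lebesgue\<bar> \<le> 2 * sobolev_norm p v" by metis
  qed
  from sobolev_weak_conv_uniform[OF p conv G]
  obtain C where "\<forall>g\<in>G. \<forall>k. \<bar>(\<integral>x. us k x * g x \<partial>lebesgue) - (\<integral>x. u x * g x \<partial>lebesgue)\<bar> \<le> C"
    by (rule exE)
  then have C: "\<bar>(\<integral>x. us k x * g x \<partial>lebesgue) - (\<integral>x. u x * g x \<partial>lebesgue)\<bar> \<le> C" if "g \<in> G" for g k
    using that by simp
  show ?thesis
  proof (rule that[of "\<bar>C\<bar>"])
    fix k and c :: 'a and R :: real assume R: "0 < R"
    let ?m = "measure lebesgue (ball c R)"
    have m: "?m > 0" using content_ball_pos[OF R, of c] by simp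
    \<comment> \<open>This \<open>g\<close> depends on \<open>k\<close>; that is harmless since
      \<open>C\<close> bounds all pairs of \<open>g\<close> and \<open>k\<close>.\<close>
    define g where "g x = ?m powr (1 / p - 1) * (sgn (w k x) * indicator (ball c R) x)" for x
    have "g \<in> borel_measurable lebesgue"
      unfolding g_def using w_measurable[of k] by measurable
    moreover have "\<bar>g x\<bar> \<le> ?m powr (1 / p - 1) * indicator (ball c R) x" for x
      by (auto simp: g_def abs_mult sgn_if indicator_def)
    ultimately have g: "g \<in> G" using R unfolding G_def by blast
    have "(\<integral>x. w k x * g x \<partial>lebesgue) = ?m powr (1 / p - 1) * (LINT x:ball c R|lebesgue. \<bar>w k x\<bar>)"
      unfolding set_lebesgue_integral_def integral_mult_right_zero[symmetric] g_def
      by (intro Bochner_Integration.integral_cong) (auto simp: indicator_def abs_sgn)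
    then have "?m powr (1 / p - 1) * (LINT x:ball c R|lebesgue. \<bar>w k x\<bar>) \<le> \<bar>C\<bar>"
      using C[OF g, of k] pairing_diff[OF G(1)[OF us g] G(1)[OF u g]] by simp
    then have le: "?m powr (1 - 1 / p) * (?m powr (1 / p - 1) * (LINT x:ball c R|lebesgue. \<bar>w k x\<bar>)) \<le> ?m powr (1 - 1 / p) * \<bar>C\<bar>"
      by (intro mult_left_mono) auto
    have cancel: "?m powr (1 - 1 / p) * (?m powr (1 / p - 1) * y) = y" for y
      using m by (simp add: mult.assoc[symmetric] powr_add[symmetric])
    show "(LINT x:ball c R|lebesgue. \<bar>w k x\<bar>) \<le> \<bar>C\<bar> * ?m powr (1 - 1 / p)"
      using le unfolding cancel by (simp only: mult.commute)
  qed simp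
qed

lemma L1_loc_convergence:
  assumes r: "0 < r"
  shows "(\<lambda>k. LINT x:ball 0 r|lebesgue. \<bar>w k x\<bar>) \<longlonglongrightarrow> 0"
proof -
  have "\<exists>f'. f' \<in> borel_measurable borel \<and> (AE x in lebesgue. w k x = f' x)" for k
    using borel_version[OF w_measurable] by metis
  then obtain w' where w'[measurable]: "\<And>k. w' k \<in> borel_measurable borel"
    and eq: "\<And>k. AE x in lebesgue. w k x = w' k x" by metis
  have pair: "(\<integral>x. w k x * g x \<partial>lebesgue) = (\<integral>x. w' k x * g x \<partial>lborel)" if g[measurable]: "g \<in> borel_measurable borel" for g k
  proof (rule integral_lebesgue_eq_lborel)
    show "(\<lambda>x. w k x * g x) \<in> borel_measurable lebesgue"
      by (intro borel_measurable_times w_measurable measurable_completion) simp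
    show "AE x in lebesgue. w k x * g x = w' k x * g x" using eq[of k] by eventually_elim simp
  qed measurable
  have set_abs: "(LINT x:ball c R|lebesgue. \<bar>w k x\<bar>) = (LINT x:ball c R|lborel. \<bar>w' k x\<bar>)" for c R k
    unfolding set_lebesgue_integral_def
  proof (rule integral_lebesgue_eq_lborel)
    show "(\<lambda>x. indicat_real (ball c R) x *\<^sub>R \<bar>w k x\<bar>) \<in> borel_measurable lebesgue"
      using w_measurable[of k] by measurable
    show "AE x in lebesgue. indicat_real (ball c R) x *\<^sub>R \<bar>w k x\<bar> = indicat_real (ball c R) x *\<^sub>R \<bar>w' k x\<bar>"
      using eq[of k] by eventually_elim simp
  qed measurable
  have loc: "set_integrable lborel (ball 0 R) (w' k)" for R k
    unfolding set_integrable_def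
  proof (rule integrable_lebesgue_imp_lborel)
    show "(\<lambda>x. indicat_real (ball 0 R) x *\<^sub>R w k x) \<in> borel_measurable lebesgue"
      using w_measurable[of k] by measurable
    show "AE x in lebesgue. indicat_real (ball 0 R) x *\<^sub>R w k x = indicat_real (ball 0 R) x *\<^sub>R w' k x"
      using eq[of k] by eventually_elim simp
    show "integrable lebesgue (\<lambda>x. indicat_real (ball 0 R) x *\<^sub>R w k x)"
      using w_loc by (simp add: set_integrable_def)
  qed measurable
  \<comment> \<open>The radius \<open>r + 1\<close> leaves room for translating test functions on
    the ball of radius \<open>r\<close> by vectors of norm at most 1.\<close>
  define G :: "('a \<Rightarrow> real) set" where "G = {\<lambda>x. frechet_derivative \<psi> (at x) b | \<psi> b.
     test_fun \<psi> \<and> (\<forall>x. \<bar>\<psi> x\<bar> \<le> 1) \<and> (\<forall>x. x \<notin> ball 0 (r + 1) \<longrightarrow> \<psi> x = 0) \<and> b \<in> Basis}"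
  have G: "integrable lebesgue (\<lambda>x. v x * g x)"
    "\<bar>\<integral>x. v x * g x \<partial>lebesgue\<bar> \<le> 2 * measure lebesgue (ball (0::'a) (r + 1)) powr (1 - 1 / p) * sobolev_norm p v"
    if "v \<in> sobolev p" "g \<in> G" for v g
    using that derivative_pairing[OF p \<open>v \<in> sobolev p\<close>, of "r + 1"] r by (auto simp: G_def)
  from sobolev_weak_conv_uniform[OF p conv G]
  obtain C where "\<forall>g\<in>G. \<forall>k. \<bar>(\<integral>x. us k x * g x \<partial>lebesgue) - (\<integral>x. u x * g x \<partial>lebesgue)\<bar> \<le> C"
    by (rule exE)
  then have C: "\<bar>(\<integral>x. us k x * g x \<partial>lebesgue) - (\<integral>x. u x * g x \<partial>lebesgue)\<bar> \<le> C" if "g \<in> G" for g k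
    using that by simp
  have deriv: "\<bar>\<integral>x. w' k x * frechet_derivative \<phi> (at x) b \<partial>lborel\<bar> \<le> C"
    if \<phi>: "test_fun \<phi>" "\<And>x. \<bar>\<phi> x\<bar> \<le> 1" "\<And>x. x \<notin> ball 0 (r + 1) \<Longrightarrow> \<phi> x = 0" and "b \<in> Basis" for k \<phi> b
  proof -
    let ?g = "\<lambda>x. frechet_derivative \<phi> (at x) b"
    have g: "?g \<in> G" using that unfolding G_def by blast
    have "(\<integral>x. w' k x * ?g x \<partial>lborel) = (\<integral>x. w k x * ?g x \<partial>lebesgue)"
      by (rule pair[symmetric]) (intro borel_measurable_continuous_onI test_fun_derivative_continuous \<phi>)
    then show ?thesis using C[OF g, of k] pairing_diff[OF G(1)[OF us g] G(1)[OF u g]] by simp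
  qed
  obtain A where A: "\<And>k c R. 0 < R \<Longrightarrow>
    (LINT x:ball c R|lebesgue. \<bar>w k x\<bar>) \<le> A * measure lebesgue (ball c R) powr (1 - 1 / p)"
    using average_bound by metis
  have ind: "(LINT z:ball x h|lborel. w' k z) = (\<integral>z. w k z * indicator (ball x h) z \<partial>lebesgue)" for x h k
    by (subst pair) (simp_all add: set_lebesgue_integral_def mult.commute)
  have "(\<lambda>k. LINT x:ball 0 r|lborel. \<bar>w' k x\<bar>) \<longlonglongrightarrow> 0"
  proof (rule L1_ball_convergence[OF w' loc])
    show "(LINT x:ball 0 r|lborel. \<bar>w' k (x + y) - w' k x\<bar>) \<le> (DIM('a) * C) * norm y" if "norm y \<le> 1" for k y
      by (rule translation_estimate[OF w' loc r that deriv])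
    show "(\<lambda>k. LINT z:ball x h|lborel. w' k z) \<longlonglongrightarrow> 0" if "0 < h" for x h
    proof -
      let ?g = "indicat_real (ball x h)"
      note * = bounded_support_pairing[OF p _ \<open>0 < h\<close>, where K = 1 and g = ?g and c = x]
      have i: "integrable lebesgue (\<lambda>x. v x * ?g x)" if "v \<in> sobolev p" for v
        by (rule *(1)[OF that]) auto
      have "(\<lambda>k. \<integral>z. us k z * ?g z \<partial>lebesgue) \<longlonglongrightarrow> (\<integral>z. u z * ?g z \<partial>lebesgue)"
        by (rule sobolev_weak_conv_pairing[OF p conv i *(2)]) auto
      then have "(\<lambda>k. (\<integral>z. us k z * ?g z \<partial>lebesgue) - (\<integral>z. u z * ?g z \<partial>lebesgue)) \<longlonglongrightarrow> 0"
        by (simp add: LIM_zero)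
      then show ?thesis unfolding ind pairing_diff[OF i[OF us] i[OF u]] .
    qed
    show "\<exists>K. \<forall>k x. \<bar>LINT z:ball x h|lborel. w' k z\<bar> \<le> K" if "0 < h" for h
    proof (intro exI allI)
      fix k x
      have "\<bar>LINT z:ball x h|lborel. w' k z\<bar> \<le> (LINT z:ball x h|lborel. \<bar>w' k z\<bar>)"
        unfolding set_lebesgue_integral_def by (rule order_trans[OF integral_abs_bound]) (simp add: abs_mult)
      also have "\<dots> \<le> A * measure lebesgue (ball x h) powr (1 - 1 / p)"
        using A[OF \<open>0 < h\<close>, of x k] by (simp add: set_abs)
      also have "measure lebesgue (ball x h) = measure lebesgue (ball (0::'a) h)"
        using \<open>0 < h\<close> content_ball_conv_unit_ball[of h x] content_ball_conv_unit_ball[of h "0::'a"] by simp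
      finally show "\<bar>LINT z:ball x h|lborel. w' k z\<bar> \<le> A * measure lebesgue (ball (0::'a) h) powr (1 - 1 / p)" .
    qed
  qed
  then show ?thesis by (simp add: set_abs)
qed

section \<open>Almost everywhere convergence along a fast subsequence\<close>

lemma fast_subsequence:
  obtains r where "strict_mono r"
    "\<And>j. (LINT x:ball 0 (2 * real (Suc j))|lebesgue. \<bar>w (r j) x\<bar>) \<le> (1/4) ^ j"
proof -
  have "\<exists>N. \<forall>k\<ge>N. (LINT x:ball 0 (2 * real (Suc j))|lebesgue. \<bar>w k x\<bar>) \<le> (1/4) ^ j" for j
  proof -
    have "eventually (\<lambda>k. (LINT x:ball 0 (2 * real (Suc j))|lebesgue. \<bar>w k x\<bar>) < (1/4) ^ j) sequentially"
      by (rule order_tendstoD(2)[OF L1_loc_convergence]) auto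
    then show ?thesis unfolding eventually_sequentially by (meson less_imp_le)
  qed
  then obtain N where N: "\<And>j k. k \<ge> N j \<Longrightarrow> (LINT x:ball 0 (2 * real (Suc j))|lebesgue. \<bar>w k x\<bar>) \<le> (1/4) ^ j"
    by metis
  \<comment> \<open>Every summand is positive, so the sums increase strictly, and the last summand
    already exceeds \<open>N j\<close>.\<close>
  define r where "r j = (\<Sum>i\<le>j. Suc (N i))" for j
  have "strict_mono r" by (rule strict_monoI_Suc) (simp add: r_def)
  moreover have "r j \<ge> N j" for j
    unfolding r_def by (rule order_trans[OF _ member_le_sum[of j]]) auto
  ultimately show ?thesis using that N by blast
qed

text \<open>The quantity \<open>m ^ DIM('a) * measure lebesgue (ball 0 1)\<close> is the volume of a
  ball of radius \<open>m\<close>. For \<open>R > m\<close> the average is at most \<open>C\<close>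
  times the volume of the ball to the power -1/p, which decreases in \<open>R\<close>. The sum of
  the two bounds serves both ranges of radii.\<close>

lemma maximal_fun_w_le:
  assumes C: "0 \<le> C" "\<And>k c R. 0 < R \<Longrightarrow>
      (LINT x:ball c R|lebesgue. \<bar>w k x\<bar>) \<le> C * measure lebesgue (ball c R) powr (1 - 1 / p)"
    and m: "0 < m" and t: "0 \<le> t"
    and small: "\<And>R. 0 < R \<Longrightarrow> R \<le> m \<Longrightarrow>
      (\<integral>\<^sup>+y\<in>ball x R. ennreal \<bar>w k y\<bar> \<partial>lebesgue) \<le> ennreal t * emeasure lebesgue (ball x R)"
  shows "maximal_fun (w k) x \<le> ennreal (t + C * (m ^ DIM('a) * measure lebesgue (ball (0::'a) 1)) powr (- (1 / p)))"
  unfolding maximal_fun_def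
proof (rule SUP_least)
  fix R :: real assume "R \<in> {0<..}"
  then have R: "0 < R" by simp
  let ?m = "measure lebesgue (ball x R)"
  let ?tail = "(m ^ DIM('a) * measure lebesgue (ball (0::'a) 1)) powr (- (1 / p))"
  have em: "emeasure lebesgue (ball x R) = ennreal ?m"
    using ball_lmeasurable by (rule emeasure_eq_measure2)
  have mpos: "?m > 0" using content_ball_pos[OF R, of x] by simp
  have "(\<integral>\<^sup>+y\<in>ball x R. ennreal \<bar>w k y\<bar> \<partial>lebesgue) \<le> emeasure lebesgue (ball x R) * ennreal (t + C * ?tail)"
  proof (cases "R \<le> m")
    case True
    note small[OF R True]
    also have "ennreal t * emeasure lebesgue (ball x R) \<le> ennreal (t + C * ?tail) * emeasure lebesgue (ball x R)"
      using C(1) by (intro mult_right_mono ennreal_leI) auto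
    finally show ?thesis by (simp add: mult.commute)
  next
    case False
    have "integrable lebesgue (\<lambda>y. indicat_real (ball x R) y *\<^sub>R \<bar>w k y\<bar>)"
      using set_integrable_abs[OF w_loc] by (simp add: set_integrable_def)
    then have "(\<integral>\<^sup>+y. ennreal (indicat_real (ball x R) y *\<^sub>R \<bar>w k y\<bar>) \<partial>lebesgue) = ennreal (LINT y:ball x R|lebesgue. \<bar>w k y\<bar>)"
      unfolding set_lebesgue_integral_def by (rule nn_integral_eq_integral) auto
    moreover have "(\<integral>\<^sup>+y. ennreal (indicat_real (ball x R) y *\<^sub>R \<bar>w k y\<bar>) \<partial>lebesgue) = (\<integral>\<^sup>+y\<in>ball x R. ennreal \<bar>w k y\<bar> \<partial>lebesgue)"
      by (intro nn_integral_cong) (auto simp: indicator_def)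
    ultimately have "(\<integral>\<^sup>+y\<in>ball x R. ennreal \<bar>w k y\<bar> \<partial>lebesgue) = ennreal (LINT y:ball x R|lebesgue. \<bar>w k y\<bar>)" by simp
    also have "\<dots> \<le> ennreal (?m * (t + C * ?tail))"
    proof (rule ennreal_leI)
      have "m ^ DIM('a) * measure lebesgue (ball (0::'a) 1) \<le> ?m"
        using content_ball_conv_unit_ball[of R x] R m False
        by (auto intro!: mult_right_mono power_mono)
      moreover have "0 < m ^ DIM('a) * measure lebesgue (ball (0::'a) 1)"
        using m content_ball_pos[of 1 "0::'a"] by simp
      ultimately have tail: "?m powr (- (1 / p)) \<le> ?tail"
        using p by (intro powr_mono2') auto
      have "(LINT y:ball x R|lebesgue. \<bar>w k y\<bar>) \<le> C * ?m powr (1 + - (1 / p))" using C(2)[OF R, of x k] by simp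
      also have "\<dots> = ?m * (C * ?m powr (- (1 / p)))" using mpos by (simp only: powr_add) simp
      also have "\<dots> \<le> ?m * (t + C * ?tail)"
        using tail t C(1) by (intro mult_left_mono add_increasing mult_left_mono) auto
      finally show "(LINT y:ball x R|lebesgue. \<bar>w k y\<bar>) \<le> ?m * (t + C * ?tail)" .
    qed
    finally show ?thesis by (simp add: em ennreal_mult')
  qed
  then show "(\<integral>\<^sup>+y\<in>ball x R. ennreal \<bar>w k y\<bar> \<partial>lebesgue) / emeasure lebesgue (ball x R) \<le> ennreal (t + C * ?tail)"
    using mpos by (intro divide_le_posI_ennreal) (auto simp: em)
qed

lemma maximal_fun_w_tendsto_0:
  obtains r where "strict_mono r" "AE x in lebesgue. (\<lambda>j. maximal_fun (w (r j)) x) \<longlonglongrightarrow> 0"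
proof -
  obtain C where C: "0 \<le> C" "\<And>k c R. 0 < R \<Longrightarrow>
      (LINT x:ball c R|lebesgue. \<bar>w k x\<bar>) \<le> C * measure lebesgue (ball c R) powr (1 - 1 / p)"
    using average_bound by metis
  obtain r where r: "strict_mono r"
    and small: "\<And>j. (LINT x:ball 0 (2 * real (Suc j))|lebesgue. \<bar>w (r j) x\<bar>) \<le> (1/4) ^ j"
    using fast_subsequence by metis
  \<comment> \<open>The weak type estimate with radius j+1 and threshold 2^(-j), packaged so that
    exceptional sets can be chosen for all \<open>j\<close> at once. \<open>Suc j\<close> keeps the
    radius positive at \<open>j = 0\<close>.\<close>
  define Q where "Q j U \<longleftrightarrow> U \<in> sets lebesgue \<and>
      emeasure lebesgue U \<le> ennreal (5 ^ DIM('a) * (1/4) ^ j / (1/2) ^ j) \<and>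
      (\<forall>x R. x \<in> ball 0 (real (Suc j)) \<longrightarrow> x \<notin> U \<longrightarrow> 0 < R \<longrightarrow> R \<le> real (Suc j) \<longrightarrow>
        (\<integral>\<^sup>+y\<in>ball x R. ennreal \<bar>w (r j) y\<bar> \<partial>lebesgue) \<le> ennreal ((1/2) ^ j) * emeasure lebesgue (ball x R))"
    for j U
  have "\<exists>U. Q j U" for j
  proof (rule weak_type_maximal[OF w_measurable w_loc _ small])
    show "(0::real) < (1/2) ^ j" by simp
  qed (auto simp only: Q_def)
  then obtain U where Q: "\<And>j. Q j (U j)" by metis
  have U: "U j \<in> sets lebesgue"
    and emU: "emeasure lebesgue (U j) \<le> ennreal (5 ^ DIM('a) * (1/4) ^ j / (1/2) ^ j)" for j
    using Q[of j] by (simp_all only: Q_def)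
  have outU: "(\<integral>\<^sup>+y\<in>ball x R. ennreal \<bar>w (r j) y\<bar> \<partial>lebesgue) \<le> ennreal ((1/2) ^ j) * emeasure lebesgue (ball x R)"
    if "x \<in> ball 0 (real (Suc j))" "x \<notin> U j" "0 < R" "R \<le> real (Suc j)" for j x R
    using Q[of j] that unfolding Q_def by blast
  \<comment> \<open>The rate 4^(-j) is used up here: one factor 2^(-j) pays for the threshold, the
    other makes the measures of the exceptional sets summable.\<close>
  have "(1/4 :: real) ^ j = (1/2) ^ j * (1/2) ^ j" for j
    by (simp add: power_mult_distrib[symmetric])
  then have emU': "emeasure lebesgue (U j) \<le> ennreal (5 ^ DIM('a) * (1/2) ^ j)" for j
    using emU[of j] by simp
  have fin: "emeasure lebesgue (U j) < \<infinity>" for j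
    using emU'[of j] by (rule le_less_trans) simp
  have "summable (\<lambda>j. measure lebesgue (U j))"
  proof (rule summable_comparison_test')
    show "summable (\<lambda>j. 5 ^ DIM('a) * (1/2) ^ j :: real)" by (intro summable_mult summable_geometric) auto
    show "norm (measure lebesgue (U j)) \<le> 5 ^ DIM('a) * (1/2) ^ j" for j
      using emU'[of j] by (simp add: measure_def enn2real_leI)
  qed
  from borel_cantelli_AE1[OF U fin this]
  have "AE x in lebesgue. eventually (\<lambda>j. x \<notin> U j) sequentially" by simp
  then have "AE x in lebesgue. (\<lambda>j. maximal_fun (w (r j)) x) \<longlonglongrightarrow> 0"
  proof eventually_elim
    case (elim x)
    define V where "V = measure lebesgue (ball (0::'a) 1)"
    have V: "V > 0" using content_ball_pos[of 1 "0::'a"] by (simp add: V_def)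
    define d where "d j = (1/2) ^ j + C * (real (Suc j) ^ DIM('a) * V) powr (- (1 / p))" for j
    have "d \<longlonglongrightarrow> 0 + C * 0"
      unfolding d_def
    proof (intro tendsto_add tendsto_mult tendsto_const)
      have "filterlim (\<lambda>j. V * real (Suc j) ^ DIM('a)) at_top sequentially"
        by (intro filterlim_tendsto_pos_mult_at_top[OF tendsto_const V] filterlim_pow_at_top
            filterlim_compose[OF filterlim_real_sequentially filterlim_Suc]) simp
      then show "(\<lambda>j. (real (Suc j) ^ DIM('a) * V) powr (- (1 / p))) \<longlonglongrightarrow> 0"
        using p by (intro tendsto_neg_powr) (auto simp: mult.commute)
    qed (simp add: LIMSEQ_realpow_zero)
    then have d0: "(\<lambda>j. ennreal (d j)) \<longlonglongrightarrow> 0"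
      using tendsto_ennrealI by fastforce
    obtain N where "norm x < real N" using reals_Archimedean2 by blast
    then have "eventually (\<lambda>j. x \<in> ball 0 (real (Suc j))) sequentially"
      by (intro eventually_sequentiallyI[of N]) simp
    with elim have "eventually (\<lambda>j. maximal_fun (w (r j)) x \<le> ennreal (d j)) sequentially"
    proof eventually_elim
      case (elim j)
      show ?case unfolding d_def V_def
        by (rule maximal_fun_w_le[OF C]) (use outU[OF elim(2,1)] in auto)
    qed
    then show ?case by (intro tendsto_sandwich[OF _ _ tendsto_const d0]) auto
  qed
  with r show ?thesis by (rule that)
qed

end

theorem theorem9:
  fixes p :: real and us :: "nat \<Rightarrow> 'a::euclidean_space \<Rightarrow> real" and u :: "'a \<Rightarrow> real"
  assumes "1 < p"
    and "sobolev_weak_conv p us u"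
  shows "\<exists>r. strict_mono r \<and>
    (AE x in lebesgue. (\<lambda>j. maximal_fun (us (r j)) x) \<longlonglongrightarrow> maximal_fun u x)"
proof -
  interpret weakly_convergent p us u by unfold_locales (rule assms)+
  obtain r where r: "strict_mono r" "AE x in lebesgue. (\<lambda>j. maximal_fun (w (r j)) x) \<longlonglongrightarrow> 0"
    by (rule maximal_fun_w_tendsto_0)
  from r(2) have "AE x in lebesgue. (\<lambda>j. maximal_fun (us (r j)) x) \<longlonglongrightarrow> maximal_fun u x"
  proof eventually_elim
    case (elim x)
    show ?case
      by (rule tendsto_ennreal_sandwich[OF maximal_fun_mono_add maximal_fun_mono_add elim])
         (auto simp: w_def intro: us_measurable u_measurable w_measurable)
  qed
  with r(1) show ?thesis by blast
qed

end
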